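(* Let $(M,\langle\cdot,\cdot\rangle)$ be a Riemannian 3-manifold without boundary, let $U\subseteq M$ be open, and let $k$ be a smooth unit vector field on $U$ with geodesic flow, i.e. $\nabla_k k=0$. Let $p\in U$ and let $\gamma$ be the (maximal, geodesic) integral curve of $k$ through $p$. Then $k$ is hypersurface-orthogonal at $p$ if and only if it is hypersurface-orthogonal at every point along $\gamma$. Moreover, if $\gamma$ is complete (defined on all of $\mathbb{R}$), $\mathrm{Ric}(k,k)\circ\gamma\geq 0$, and $k$ is hypersurface-orthogonal along $\gamma$ (at each of its points), then $(\mathrm{div}\,k)\circ\gamma\geq 0$.
   Context: $\nabla$ is the Levi-Civita connection. For a smooth unit vector field $k$ on an open set $U$ and $q\in U$, choose a local orthonormal frame $\{k,x,y\}$ near $q$. The rotation of $k$ is $\omega=\langle\nabla_y k,x\rangle-\langle\nabla_x k,y\rangle$, which is independent of the choice of $x,y$ up to sign. The vector field $k$ is called hypersurface-orthogonal at $q$ if $\omega(q)=0$ (equivalently $\langle k,[x,y]\rangle|_q=0$). The divergence is $\mathrm{div}\,k=\langle\nabla_x k,x\rangle+\langle\nabla_y k,y\rangle$ (the trace of $v\mapsto\nabla_v k$). The sign convention for $\mathrm{Ric}$ is the standard one, in which round spheres have positive Ricci curvature. *)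

theory Defs
  imports "HOL-Analysis.Analysis"
begin

section \<open>Smooth maps between Euclidean spaces\<close>

text \<open>Only meaningful on open sets: \<open>C_k_on n f S\<close> says that all iterated directional
  derivatives of \<open>f\<close> up to order \<open>n\<close> exist (as Frechet derivatives) and are continuous on \<open>S\<close>.\<close>

primrec C_k_on :: "nat \<Rightarrow> ('e::euclidean_space \<Rightarrow> 'f::euclidean_space) \<Rightarrow> 'e set \<Rightarrow> bool" where
  "C_k_on 0 f S \<longleftrightarrow> continuous_on S f"
| "C_k_on (Suc n) f S \<longleftrightarrow>
     (\<forall>x\<in>S. f differentiable (at x)) \<and> (\<forall>v. C_k_on n (\<lambda>x. frechet_derivative f (at x) v) S)"

definition smooth_map_on :: "'e::euclidean_space set \<Rightarrow> ('e \<Rightarrow> 'f::euclidean_space) \<Rightarrow> bool" where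
  "smooth_map_on S f \<longleftrightarrow> (\<forall>n. C_k_on n f S)"


section \<open>Smooth 3-manifolds\<close>

text \<open>A chart is a pair of its domain and its coordinate map; the manifold is \<open>topspace M\<close>. Charts
  map onto open subsets of \<open>\<real>\<^sup>3\<close>, so there is no boundary. The atlas need not be maximal.\<close>

type_synonym 'a chart = "'a set \<times> ('a \<Rightarrow> real^3)"

definition smooth_3_manifold :: "'a topology \<Rightarrow> 'a chart set \<Rightarrow> bool" where
  "smooth_3_manifold M A \<longleftrightarrow>
     Hausdorff_space M \<and> second_countable M \<and>
     (\<forall>(D, \<phi>)\<in>A. openin M D \<and> open (\<phi> ` D) \<and>
        homeomorphic_map (subtopology M D) (top_of_set (\<phi> ` D)) \<phi>) \<and>
     (\<Union>(D, \<phi>)\<in>A. D) = topspace M \<and>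
     (\<forall>(D, \<phi>)\<in>A. \<forall>(E, \<psi>)\<in>A. smooth_map_on (\<phi> ` (D \<inter> E)) (\<psi> \<circ> inv_into D \<phi>))"

definition smooth_fun :: "'a chart set \<Rightarrow> 'a set \<Rightarrow> ('a \<Rightarrow> real) \<Rightarrow> bool" where
  "smooth_fun A W f \<longleftrightarrow> (\<forall>(D, \<phi>)\<in>A. smooth_map_on (\<phi> ` (D \<inter> W)) (f \<circ> inv_into D \<phi>))"

definition smooth_near :: "'a topology \<Rightarrow> 'a chart set \<Rightarrow> 'a \<Rightarrow> ('a \<Rightarrow> real) \<Rightarrow> bool" where
  "smooth_near M A p f \<longleftrightarrow> (\<exists>W. openin M W \<and> p \<in> W \<and> smooth_fun A W f)"

definition smooth_curve :: "'a topology \<Rightarrow> 'a chart set \<Rightarrow> real set \<Rightarrow> (real \<Rightarrow> 'a) \<Rightarrow> bool" where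
  "smooth_curve M A I \<alpha> \<longleftrightarrow>
     open I \<and> continuous_map (top_of_set I) M \<alpha> \<and>
     (\<forall>(D, \<phi>)\<in>A. smooth_map_on (I \<inter> \<alpha> -` D) (\<phi> \<circ> \<alpha>))"


section \<open>Tangent vectors and vector fields\<close>

text \<open>A tangent vector at \<open>p\<close> is the operator \<open>f \<mapsto> (f \<circ> \<alpha>)'(0)\<close> given by the velocity of a smooth
  curve \<open>\<alpha>\<close> with \<open>\<alpha> 0 = p\<close>, acting on functions that are smooth near \<open>p\<close>. Its value on all other
  functions is normalised to 0, so that equality of tangent vectors is equality of operators.\<close>

type_synonym 'a tvec = "('a \<Rightarrow> real) \<Rightarrow> real"

definition velocity :: "'a topology \<Rightarrow> 'a chart set \<Rightarrow> (real \<Rightarrow> 'a) \<Rightarrow> real \<Rightarrow> 'a tvec" where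
  "velocity M A \<alpha> t = (\<lambda>f. if smooth_near M A (\<alpha> t) f then deriv (f \<circ> \<alpha>) t else 0)"

definition tangent_space :: "'a topology \<Rightarrow> 'a chart set \<Rightarrow> 'a \<Rightarrow> 'a tvec set" where
  "tangent_space M A p =
     {velocity M A \<alpha> 0 |\<alpha>. \<alpha> 0 = p \<and> (\<exists>e>0. smooth_curve M A {-e<..<e} \<alpha>)}"

definition tv_zero :: "'a tvec" where
  "tv_zero = (\<lambda>f. 0)"

definition tv_add :: "'a tvec \<Rightarrow> 'a tvec \<Rightarrow> 'a tvec" (infixl \<open>+\<^sub>T\<close> 65) where
  "u +\<^sub>T v = (\<lambda>f. u f + v f)"

definition tv_diff :: "'a tvec \<Rightarrow> 'a tvec \<Rightarrow> 'a tvec" (infixl \<open>-\<^sub>T\<close> 65) where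
  "u -\<^sub>T v = (\<lambda>f. u f - v f)"

definition tv_scale :: "real \<Rightarrow> 'a tvec \<Rightarrow> 'a tvec" (infixr \<open>*\<^sub>T\<close> 75) where
  "a *\<^sub>T v = (\<lambda>f. a * v f)"

text \<open>Vector fields are total functions; only the values on the set under consideration matter.\<close>

type_synonym 'a vfield = "'a \<Rightarrow> 'a tvec"

definition smooth_vfield :: "'a topology \<Rightarrow> 'a chart set \<Rightarrow> 'a set \<Rightarrow> 'a vfield \<Rightarrow> bool" where
  "smooth_vfield M A W X \<longleftrightarrow>
     (\<forall>p\<in>W. X p \<in> tangent_space M A p) \<and>
     (\<forall>V f. openin M V \<and> V \<subseteq> W \<and> smooth_fun A V f \<longrightarrow> smooth_fun A V (\<lambda>q. X q f))"

definition lie_bracket :: "'a topology \<Rightarrow> 'a chart set \<Rightarrow> 'a vfield \<Rightarrow> 'a vfield \<Rightarrow> 'a vfield" where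
  "lie_bracket M A X Y p =
     (\<lambda>f. if smooth_near M A p f then X p (\<lambda>q. Y q f) - Y p (\<lambda>q. X q f) else 0)"


section \<open>Riemannian metrics and the Levi-Civita connection\<close>

type_synonym 'a metric = "'a \<Rightarrow> 'a tvec \<Rightarrow> 'a tvec \<Rightarrow> real"

definition riemannian_metric :: "'a topology \<Rightarrow> 'a chart set \<Rightarrow> 'a metric \<Rightarrow> bool" where
  "riemannian_metric M A g \<longleftrightarrow>
     (\<forall>p\<in>topspace M. \<forall>u\<in>tangent_space M A p. \<forall>v\<in>tangent_space M A p.
        g p u v = g p v u \<and>
        (u \<noteq> tv_zero \<longrightarrow> g p u u > 0) \<and>
        (\<forall>w\<in>tangent_space M A p. \<forall>a b. g p (a *\<^sub>T u +\<^sub>T b *\<^sub>T v) w = a * g p u w + b * g p v w)) \<and>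
     (\<forall>W X Y. openin M W \<and> smooth_vfield M A W X \<and> smooth_vfield M A W Y \<longrightarrow>
        smooth_fun A W (\<lambda>p. g p (X p) (Y p)))"

definition riemannian_3_manifold :: "'a topology \<Rightarrow> 'a chart set \<Rightarrow> 'a metric \<Rightarrow> bool" where
  "riemannian_3_manifold M A g \<longleftrightarrow> smooth_3_manifold M A \<and> riemannian_metric M A g"

text \<open>For a connection \<open>nab\<close>, the value \<open>nab p v Y\<close> is the covariant derivative of \<open>Y\<close> at \<open>p\<close> in the
  direction \<open>v\<close> of the tangent space at \<open>p\<close>, where \<open>Y\<close> is a smooth vector field on some open
  neighbourhood of \<open>p\<close>. The fifth clause is locality; it also makes the value independent of the
  irrelevant values of \<open>Y\<close> outside the neighbourhood. This is the usual extension of a connection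
  on globally defined vector fields to locally defined ones.\<close>

type_synonym 'a connection = "'a \<Rightarrow> 'a tvec \<Rightarrow> 'a vfield \<Rightarrow> 'a tvec"

definition affine_connection :: "'a topology \<Rightarrow> 'a chart set \<Rightarrow> 'a connection \<Rightarrow> bool" where
  "affine_connection M A nab \<longleftrightarrow>
     (\<forall>W Y Z. openin M W \<and> smooth_vfield M A W Y \<and> smooth_vfield M A W Z \<longrightarrow>
        (\<forall>p\<in>W. \<forall>v\<in>tangent_space M A p.
           nab p v Y \<in> tangent_space M A p \<and>
           (\<forall>u\<in>tangent_space M A p. \<forall>a b.
              nab p (a *\<^sub>T u +\<^sub>T b *\<^sub>T v) Y = a *\<^sub>T nab p u Y +\<^sub>T b *\<^sub>T nab p v Y) \<and>
           nab p v (\<lambda>q. Y q +\<^sub>T Z q) = nab p v Y +\<^sub>T nab p v Z \<and>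
           (\<forall>f. smooth_fun A W f \<longrightarrow>
              nab p v (\<lambda>q. f q *\<^sub>T Y q) = v f *\<^sub>T Y p +\<^sub>T f p *\<^sub>T nab p v Y) \<and>
           ((\<forall>q\<in>W. Y q = Z q) \<longrightarrow> nab p v Y = nab p v Z)) \<and>
        smooth_vfield M A W (\<lambda>p. nab p (Z p) Y))"

definition levi_civita :: "'a topology \<Rightarrow> 'a chart set \<Rightarrow> 'a metric \<Rightarrow> 'a connection \<Rightarrow> bool" where
  "levi_civita M A g nab \<longleftrightarrow>
     affine_connection M A nab \<and>
     (\<forall>W X Y. openin M W \<and> smooth_vfield M A W X \<and> smooth_vfield M A W Y \<longrightarrow>
        (\<forall>p\<in>W.
           nab p (X p) Y -\<^sub>T nab p (Y p) X = lie_bracket M A X Y p \<and>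
           (\<forall>v\<in>tangent_space M A p.
              v (\<lambda>q. g q (X q) (Y q)) = g p (nab p v X) (Y p) + g p (X p) (nab p v Y))))"


section \<open>Curvature, rotation and divergence\<close>

definition local_orthonormal_frame ::
  "'a topology \<Rightarrow> 'a chart set \<Rightarrow> 'a metric \<Rightarrow> 'a \<Rightarrow> 'a vfield \<Rightarrow> 'a vfield \<Rightarrow> 'a vfield \<Rightarrow> bool" where
  "local_orthonormal_frame M A g q x y z \<longleftrightarrow>
     (\<exists>W. openin M W \<and> q \<in> W \<and>
        smooth_vfield M A W x \<and> smooth_vfield M A W y \<and> smooth_vfield M A W z \<and>
        (\<forall>r\<in>W. g r (x r) (x r) = 1 \<and> g r (y r) (y r) = 1 \<and> g r (z r) (z r) = 1 \<and>
               g r (x r) (y r) = 0 \<and> g r (x r) (z r) = 0 \<and> g r (y r) (z r) = 0))"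

definition curvature ::
  "'a topology \<Rightarrow> 'a chart set \<Rightarrow> 'a connection \<Rightarrow> 'a vfield \<Rightarrow> 'a vfield \<Rightarrow> 'a vfield \<Rightarrow> 'a vfield" where
  "curvature M A nab X Y Z p =
     nab p (X p) (\<lambda>q. nab q (Y q) Z) -\<^sub>T nab p (Y p) (\<lambda>q. nab q (X q) Z)
       -\<^sub>T nab p (lie_bracket M A X Y p) Z"

text \<open>\<open>Ric(Y, Z)\<close> is the trace of \<open>X \<mapsto> R(X, Y) Z\<close>, which with the above sign of \<open>R\<close> is positive on
  round spheres. Here and in \<open>divergence\<close> the result does not depend on the chosen frame.\<close>

definition ricci ::
  "'a topology \<Rightarrow> 'a chart set \<Rightarrow> 'a metric \<Rightarrow> 'a connection \<Rightarrow> 'a vfield \<Rightarrow> 'a vfield \<Rightarrow> 'a \<Rightarrow> real" where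
  "ricci M A g nab Y Z q =
     (let (a, b, c) = (SOME (a, b, c). local_orthonormal_frame M A g q a b c) in
        g q (curvature M A nab a Y Z q) (a q) +
        g q (curvature M A nab b Y Z q) (b q) +
        g q (curvature M A nab c Y Z q) (c q))"

text \<open>In the remaining definitions \<open>k\<close> is a smooth unit vector field near \<open>q\<close>.\<close>

definition rotation ::
  "'a metric \<Rightarrow> 'a connection \<Rightarrow> 'a vfield \<Rightarrow> 'a vfield \<Rightarrow> 'a vfield \<Rightarrow> 'a \<Rightarrow> real" where
  "rotation g nab k x y q = g q (nab q (y q) k) (x q) - g q (nab q (x q) k) (y q)"

text \<open>For different choices of \<open>x, y\<close> the rotation at \<open>q\<close> agrees up to sign, so its vanishing for one
  frame \<open>k, x, y\<close> near \<open>q\<close> is the same as its vanishing for all of them.\<close>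

definition hypersurface_orthogonal ::
  "'a topology \<Rightarrow> 'a chart set \<Rightarrow> 'a metric \<Rightarrow> 'a connection \<Rightarrow> 'a vfield \<Rightarrow> 'a \<Rightarrow> bool" where
  "hypersurface_orthogonal M A g nab k q \<longleftrightarrow>
     (\<exists>x y. local_orthonormal_frame M A g q k x y \<and> rotation g nab k x y q = 0)"

definition divergence ::
  "'a topology \<Rightarrow> 'a chart set \<Rightarrow> 'a metric \<Rightarrow> 'a connection \<Rightarrow> 'a vfield \<Rightarrow> 'a \<Rightarrow> real" where
  "divergence M A g nab k q =
     (let (x, y) = (SOME (x, y). local_orthonormal_frame M A g q k x y) in
        g q (nab q (x q) k) (x q) + g q (nab q (y q) k) (y q))"


section \<open>Integral curves\<close>

definition integral_curve ::
  "'a topology \<Rightarrow> 'a chart set \<Rightarrow> 'a set \<Rightarrow> 'a vfield \<Rightarrow> real set \<Rightarrow> (real \<Rightarrow> 'a) \<Rightarrow> bool" where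
  "integral_curve M A U k J \<gamma> \<longleftrightarrow>
     is_interval J \<and> smooth_curve M A J \<gamma> \<and> (\<forall>t\<in>J. \<gamma> t \<in> U \<and> velocity M A \<gamma> t = k (\<gamma> t))"

definition maximal_integral_curve ::
  "'a topology \<Rightarrow> 'a chart set \<Rightarrow> 'a set \<Rightarrow> 'a vfield \<Rightarrow> 'a \<Rightarrow> real set \<Rightarrow> (real \<Rightarrow> 'a) \<Rightarrow> bool" where
  "maximal_integral_curve M A U k p J \<gamma> \<longleftrightarrow>
     integral_curve M A U k J \<gamma> \<and> 0 \<in> J \<and> \<gamma> 0 = p \<and>
     (\<forall>J' \<gamma>'. integral_curve M A U k J' \<gamma>' \<and> J \<subseteq> J' \<and> (\<forall>t\<in>J. \<gamma>' t = \<gamma> t) \<longrightarrow> J' = J)"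

end

theory Submission
  imports Defs
begin

text \<open>Write \<open>\<theta>\<close> for the form \<open>v \<mapsto> \<langle>k, v\<rangle>\<close>. Twice the skew part of \<open>v \<mapsto> \<nabla>\<^sub>v k\<close>, here \<open>twist\<close>, is
\<open>- d\<theta>\<close>, and for sections \<open>X, Y\<close> of the plane field \<open>k\<^sup>\<bottom>\<close> it equals \<open>\<langle>k, [X, Y]\<rangle>\<close>. As \<open>k\<close> is unit
and geodesic, \<open>k\<close> itself lies in the kernel of \<open>twist\<close>, so on the 3-dimensional tangent space
the form is determined by its one value \<open>\<omega> = twist x y\<close>. Hence being hypersurface-orthogonal at
\<open>q\<close> means that \<open>twist\<close> vanishes at \<open>q\<close>, whichever frame is used.

Along \<open>k\<close>, the number \<open>\<omega>\<close> solves a linear equation. Indeed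
\<open>k \<omega> = k \<langle>k, [x, y]\<rangle> = \<langle>k, [k, [x, y]]\<rangle>\<close>, because \<open>\<nabla>\<^sub>k k = 0\<close> and \<open>\<langle>k, \<nabla>\<^sub>v k\<rangle> = 0\<close>, and the
Jacobi identity turns this into \<open>twist x [k, y] - twist y [k, x] = - (div k) \<omega>\<close> (lemma
\<open>rotation_evolution\<close>). So on a piece of the curve covered by one frame \<open>\<omega>\<close> vanishes everywhere
or nowhere, and connectedness of the parameter interval gives the equivalence
(\<open>hypersurface_orthogonal_along_curve\<close>).

For the second part let \<open>(a, b; c, d)\<close> be the matrix of \<open>v \<mapsto> \<nabla>\<^sub>v k\<close> on \<open>k\<^sup>\<bottom>\<close>. Differentiating
its trace gives Raychaudhuri's equation \<open>k (a + d) = - Ric(k, k) - (a\<^sup>2 + 2 b c + d\<^sup>2)\<close> (lemma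
\<open>raychaudhuri\<close>). If \<open>\<omega> = 0\<close>, then \<open>b = c\<close>, the quadratic term is at least \<open>(a + d)\<^sup>2 / 2\<close>, and
the divergence \<open>D\<close> along the curve satisfies \<open>D' \<le> - D\<^sup>2 / 2\<close>. A function of this kind that is
negative somewhere tends to \<open>- \<infinity>\<close> in finite time, which a complete curve excludes
(\<open>riccati_nonneg\<close>).

All this rests on a calculus in charts: tangent spaces are copies of \<open>\<real>\<^sup>3\<close> via any chart,
Gram-Schmidt extends \<open>k\<close> to a local orthonormal frame, and the trace of an endomorphism can be
computed in any orthonormal frame. The latter is needed for \<open>divergence\<close> and \<open>ricci\<close>, which are
defined by an arbitrary choice of frame; for \<open>ricci\<close> this frame need not contain \<open>k\<close>, so the
curvature has to be shown tensorial first.\<close>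

section \<open>Calculus of smooth maps\<close>

lemma C_k_on_subset: "C_k_on n f S \<Longrightarrow> T \<subseteq> S \<Longrightarrow> C_k_on n f T"
  by (induction n arbitrary: f) (auto intro: continuous_on_subset)

lemma C_k_on_cong:
  assumes "open S" "\<And>x. x \<in> S \<Longrightarrow> f x = g x" "C_k_on n f S"
  shows "C_k_on n g S"
  using assms(2,3)
proof (induction n arbitrary: f g)
  case 0
  then show ?case using continuous_on_cong[of S S f g] by simp
next
  case (Suc n)
  have d: "f differentiable (at x)" if "x \<in> S" for x
    using Suc.prems(2) that by simp
  have g': "(g has_derivative frechet_derivative f (at x)) (at x)" if "x \<in> S" for x
    using d[OF that] assms(1) that Suc.prems(1)
    by (auto simp: frechet_derivative_works intro: has_derivative_transform_within_open)
  have eq: "frechet_derivative f (at x) = frechet_derivative g (at x)" if "x \<in> S" for x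
    using frechet_derivative_at[OF g'[OF that]] .
  have "C_k_on n (\<lambda>x. frechet_derivative g (at x) v) S" for v
    by (rule Suc.IH[of "\<lambda>x. frechet_derivative f (at x) v"]) (use Suc.prems(2) eq in auto)
  then show ?case using g' by (auto simp: differentiable_def)
qed

text \<open>Any family of derivatives can be used to check \<open>C_k_on (Suc n)\<close>, so that the closure properties
below reduce by induction on the order to the differentiation rules.\<close>

lemma C_k_on_SucI:
  assumes "open S" "\<And>x. x \<in> S \<Longrightarrow> (f has_derivative f' x) (at x)"
    and "\<And>v. C_k_on n (\<lambda>x. f' x v) S"
  shows "C_k_on (Suc n) f S"
proof -
  have "frechet_derivative f (at x) = f' x" if "x \<in> S" for x
    using frechet_derivative_at[OF assms(2)[OF that]] by simp
  then have "C_k_on n (\<lambda>x. frechet_derivative f (at x) v) S" for v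
    using C_k_on_cong[OF assms(1) _ assms(3)[of v]] by simp
  then show ?thesis using assms(2) by (auto simp: differentiable_def)
qed

lemma C_k_on_has_derivative:
  "C_k_on (Suc n) f S \<Longrightarrow> x \<in> S \<Longrightarrow> (f has_derivative frechet_derivative f (at x)) (at x)"
  by (simp add: frechet_derivative_works)

lemma C_k_on_Suc_imp: "C_k_on (Suc n) f S \<Longrightarrow> C_k_on n f S"
proof (induction n arbitrary: f)
  case 0
  then show ?case
    by (auto intro!: continuous_at_imp_continuous_on differentiable_imp_continuous_within)
next
  case (Suc n)
  then show ?case by (metis C_k_on.simps(2))
qed

lemma C_k_on_const: "open S \<Longrightarrow> C_k_on n (\<lambda>x. c) S"
proof (induction n arbitrary: c)
  case (Suc n)
  show ?case
    by (rule C_k_on_SucI[where f' = "\<lambda>x v. 0"]) (use Suc in auto)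
qed auto

lemma C_k_on_linear:
  assumes L: "bounded_linear L" and S: "open S" and f: "C_k_on n f S"
  shows "C_k_on n (\<lambda>x. L (f x)) S"
  using f
proof (induction n arbitrary: f)
  case 0
  then show ?case using L by (auto intro: bounded_linear.continuous_on)
next
  case (Suc n)
  show ?case
  proof (rule C_k_on_SucI[OF S])
    show "((\<lambda>x. L (f x)) has_derivative (\<lambda>v. L (frechet_derivative f (at x) v))) (at x)" if "x \<in> S" for x
      using bounded_linear.has_derivative[OF L C_k_on_has_derivative[OF Suc.prems that]] .
    show "C_k_on n (\<lambda>x. L (frechet_derivative f (at x) v)) S" for v
      by (rule Suc.IH) (use Suc.prems in auto)
  qed
qed

lemma C_k_on_id:
  assumes "open S"
  shows "C_k_on n (\<lambda>x. x) S"
proof (cases n)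
  case (Suc m)
  then show ?thesis
    using C_k_on_SucI[OF assms, of "\<lambda>x. x" "\<lambda>x v. v" m] assms by (simp add: C_k_on_const)
qed auto

lemma C_k_on_add:
  assumes S: "open S" and "C_k_on n f S" "C_k_on n g S"
  shows "C_k_on n (\<lambda>x. f x + g x) S"
  using assms(2,3)
proof (induction n arbitrary: f g)
  case 0
  then show ?case by (auto intro: continuous_on_add)
next
  case (Suc n)
  show ?case
  proof (rule C_k_on_SucI[OF S])
    show "((\<lambda>x. f x + g x) has_derivative
        (\<lambda>v. frechet_derivative f (at x) v + frechet_derivative g (at x) v)) (at x)" if "x \<in> S" for x
      using Suc.prems[THEN C_k_on_has_derivative, OF that] by (rule has_derivative_add)
    show "C_k_on n (\<lambda>x. frechet_derivative f (at x) v + frechet_derivative g (at x) v) S" for v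
      by (rule Suc.IH) (use Suc.prems in auto)
  qed
qed

lemma C_k_on_sum:
  assumes S: "open S" and "\<And>i. i \<in> I \<Longrightarrow> C_k_on n (f i) S"
  shows "C_k_on n (\<lambda>x. \<Sum>i\<in>I. f i x) S"
  using assms(2)
  by (induction I rule: infinite_finite_induct) (auto intro: C_k_on_const C_k_on_add S)

lemma C_k_on_scaleR:
  assumes S: "open S" and "C_k_on n f S" "C_k_on n g S"
  shows "C_k_on n (\<lambda>x. f x *\<^sub>R g x) S"
  using assms(2,3)
proof (induction n arbitrary: f g)
  case 0
  then show ?case by (auto intro: continuous_on_scaleR)
next
  case (Suc n)
  show ?case
  proof (rule C_k_on_SucI[OF S])
    show "((\<lambda>x. f x *\<^sub>R g x) has_derivative
        (\<lambda>v. f x *\<^sub>R frechet_derivative g (at x) v + frechet_derivative f (at x) v *\<^sub>R g x)) (at x)"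
      if "x \<in> S" for x
      using Suc.prems[THEN C_k_on_has_derivative, OF that] by (rule has_derivative_scaleR)
    show "C_k_on n (\<lambda>x. f x *\<^sub>R frechet_derivative g (at x) v + frechet_derivative f (at x) v *\<^sub>R g x) S" for v
      by (intro C_k_on_add[OF S] Suc.IH) (use Suc.prems C_k_on_Suc_imp in auto)
  qed
qed

lemma linear_expand_Basis: 
  fixes L :: "'e::euclidean_space \<Rightarrow> 'f::real_vector"
  assumes "linear L" shows "L v = (\<Sum>b\<in>Basis. (v \<bullet> b) *\<^sub>R L b)"
proof -
  have "L v = L (\<Sum>b\<in>Basis. (v \<bullet> b) *\<^sub>R b)" by (simp add: euclidean_representation)
  then show ?thesis using assms by (simp add: linear_sum linear_scale)
qed

text \<open>Expanding the inner derivative in a basis makes the derivative of a composition a sum of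
products of lower order compositions, to which the induction hypothesis applies.\<close>

lemma C_k_on_compose:
  assumes S: "open S" and T: "open T" and "f ` S \<subseteq> T" and "C_k_on n f S" "C_k_on n g T"
  shows "C_k_on n (\<lambda>x. g (f x)) S"
  using assms(4,5)
proof (induction n arbitrary: g)
  case 0
  then show ?case using continuous_on_compose2 assms(3) by auto
next
  case (Suc n)
  let ?f' = "\<lambda>x. frechet_derivative f (at x)" and ?g' = "\<lambda>y. frechet_derivative g (at y)"
  show ?case
  proof (rule C_k_on_SucI[OF S])
    fix x assume x: "x \<in> S"
    have g': "(g has_derivative ?g' (f x)) (at (f x))"
      using C_k_on_has_derivative[OF Suc.prems(2)] assms(3) x by blast
    have "((\<lambda>x. g (f x)) has_derivative (\<lambda>v. ?g' (f x) (?f' x v))) (at x)"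
      using has_derivative_compose[OF C_k_on_has_derivative[OF Suc.prems(1) x] g'] .
    also have "(\<lambda>v. ?g' (f x) (?f' x v)) = (\<lambda>v. \<Sum>b\<in>Basis. (?f' x v \<bullet> b) *\<^sub>R ?g' (f x) b)"
      by (intro ext linear_expand_Basis has_derivative_linear[OF g'])
    finally show "((\<lambda>x. g (f x)) has_derivative \<dots>) (at x)" .
  next
    fix v
    have f': "C_k_on n (\<lambda>x. ?f' x v) S" and g': "C_k_on n (\<lambda>y. ?g' y b) T" for b
      using Suc.prems by simp_all
    show "C_k_on n (\<lambda>x. \<Sum>b\<in>Basis. (?f' x v \<bullet> b) *\<^sub>R ?g' (f x) b) S"
    proof (intro C_k_on_sum[OF S] C_k_on_scaleR[OF S])
      show "C_k_on n (\<lambda>x. ?f' x v \<bullet> b) S" for b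
        by (rule C_k_on_linear[OF bounded_linear_inner_left S f'])
      show "C_k_on n (\<lambda>x. ?g' (f x) b) S" for b
        by (rule Suc.IH[OF C_k_on_Suc_imp[OF Suc.prems(1)] g'])
    qed
  qed
qed

lemma C_k_on_powr: "C_k_on n (\<lambda>x::real. x powr a) {0<..}"
proof (induction n arbitrary: a)
  case 0
  then show ?case by (auto intro!: continuous_intros)
next
  case (Suc n)
  show ?case
  proof (rule C_k_on_SucI)
    show "((\<lambda>x. x powr a) has_derivative (\<lambda>v. v *\<^sub>R (a *\<^sub>R x powr (a - 1)))) (at x)" if "x \<in> {0<..}" for x :: real
      using that has_real_derivative_powr[of x a]
      by (simp add: has_field_derivative_def mult.commute mult_commute_abs)
    show "C_k_on n (\<lambda>x::real. v *\<^sub>R (a *\<^sub>R x powr (a - 1))) {0<..}" for v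
      by (intro C_k_on_scaleR C_k_on_const Suc.IH) auto
  qed auto
qed

lemma smooth_map_on_subset: "smooth_map_on S f \<Longrightarrow> T \<subseteq> S \<Longrightarrow> smooth_map_on T f"
  unfolding smooth_map_on_def using C_k_on_subset by blast

lemma smooth_map_on_cong:
  "open S \<Longrightarrow> (\<And>x. x \<in> S \<Longrightarrow> f x = g x) \<Longrightarrow> smooth_map_on S f \<Longrightarrow> smooth_map_on S g"
  unfolding smooth_map_on_def using C_k_on_cong by blast

lemma smooth_map_on_const: "open S \<Longrightarrow> smooth_map_on S (\<lambda>x. c)"
  and smooth_map_on_id: "open S \<Longrightarrow> smooth_map_on S (\<lambda>x. x)"
  and smooth_map_on_linear: "bounded_linear L \<Longrightarrow> open S \<Longrightarrow> smooth_map_on S f \<Longrightarrow> smooth_map_on S (\<lambda>x. L (f x))"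
  and smooth_map_on_add: "open S \<Longrightarrow> smooth_map_on S f \<Longrightarrow> smooth_map_on S g \<Longrightarrow> smooth_map_on S (\<lambda>x. f x + g x)"
  and smooth_map_on_scaleR: "open S \<Longrightarrow> smooth_map_on S h \<Longrightarrow> smooth_map_on S g \<Longrightarrow> smooth_map_on S (\<lambda>x. h x *\<^sub>R g x)"
  and smooth_map_on_powr: "smooth_map_on {0<..} (\<lambda>x::real. x powr a)"
  unfolding smooth_map_on_def
  by (simp_all add: C_k_on_const C_k_on_id C_k_on_linear C_k_on_add C_k_on_scaleR C_k_on_powr)

lemma smooth_map_on_compose:
  "open S \<Longrightarrow> open T \<Longrightarrow> f ` S \<subseteq> T \<Longrightarrow> smooth_map_on S f \<Longrightarrow> smooth_map_on T g \<Longrightarrow>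
   smooth_map_on S (\<lambda>x. g (f x))"
  unfolding smooth_map_on_def using C_k_on_compose by blast

lemma smooth_map_on_derivative: 
  assumes "smooth_map_on S f" shows "smooth_map_on S (\<lambda>x. frechet_derivative f (at x) v)"
  using assms unfolding smooth_map_on_def by (metis C_k_on.simps(2))

lemma smooth_map_on_has_derivative:
  "smooth_map_on S f \<Longrightarrow> x \<in> S \<Longrightarrow> (f has_derivative frechet_derivative f (at x)) (at x)"
  unfolding smooth_map_on_def using C_k_on_has_derivative by blast

lemma smooth_map_on_imp_continuous_on: "smooth_map_on S f \<Longrightarrow> continuous_on S f"
  unfolding smooth_map_on_def by (metis C_k_on.simps(1))

section \<open>Smooth functions on a 3-manifold\<close>

locale manifold3 =
  fixes M :: "'a topology" and A :: "'a chart set"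
  assumes manifold: "smooth_3_manifold M A"
begin

lemma chart_openin: "(D, \<phi>) \<in> A \<Longrightarrow> openin M D"
  and chart_open_image: "(D, \<phi>) \<in> A \<Longrightarrow> open (\<phi> ` D)"
  and chart_homeo: "(D, \<phi>) \<in> A \<Longrightarrow> homeomorphic_map (subtopology M D) (top_of_set (\<phi> ` D)) \<phi>"
  and transition_smooth: "(D, \<phi>) \<in> A \<Longrightarrow> (E, \<psi>) \<in> A \<Longrightarrow>
        smooth_map_on (\<phi> ` (D \<inter> E)) (\<lambda>x. \<psi> (inv_into D \<phi> x))"
  using manifold unfolding smooth_3_manifold_def comp_def by fast+

lemma chart_subset: "(D, \<phi>) \<in> A \<Longrightarrow> D \<subseteq> topspace M"
  using chart_openin openin_subset by blast

lemma chart_inj: "(D, \<phi>) \<in> A \<Longrightarrow> inj_on \<phi> D"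
  using chart_homeo[THEN homeomorphic_imp_injective_map] chart_subset
  by (metis topspace_subtopology_subset)

lemma chart_inv: "(D, \<phi>) \<in> A \<Longrightarrow> q \<in> D \<Longrightarrow> inv_into D \<phi> (\<phi> q) = q"
  by (simp add: chart_inj)

lemma chart_mem_image_iff: "(D, \<phi>) \<in> A \<Longrightarrow> q \<in> D \<Longrightarrow> \<phi> q \<in> \<phi> ` (D \<inter> V) \<longleftrightarrow> q \<in> V"
  using inj_on_image_mem_iff[OF chart_inj, of D \<phi> q "D \<inter> V"] by simp

lemma chart_at:
  assumes "p \<in> topspace M"
  obtains D \<phi> where "(D, \<phi>) \<in> A" "p \<in> D"
proof -
  have "(\<Union>(D, \<phi>)\<in>A. D) = topspace M"
    using manifold unfolding smooth_3_manifold_def by blast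
  with assms have "p \<in> (\<Union>(D, \<phi>)\<in>A. D)" by simp
  then show thesis using that by auto
qed

lemma chart_image_open:
  assumes c: "(D, \<phi>) \<in> A" and W: "openin M W"
  shows "open (\<phi> ` (D \<inter> W))"
proof -
  have "openin (subtopology M D) (D \<inter> W)"
    using W by (auto simp: openin_subtopology)
  then have "openin (top_of_set (\<phi> ` D)) (\<phi> ` (D \<inter> W))"
    using homeomorphic_imp_open_map[OF chart_homeo[OF c]] unfolding open_map_def by blast
  then show ?thesis using chart_open_image[OF c] openin_open_eq by blast
qed

lemma chart_preimage_openin:
  assumes c: "(D, \<phi>) \<in> A" and T: "open T"
  shows "openin M {q \<in> D. \<phi> q \<in> T}"
proof -
  have "continuous_map (subtopology M D) (top_of_set (\<phi> ` D)) \<phi>"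
    using homeomorphic_imp_continuous_map[OF chart_homeo[OF c]] .
  then have "continuous_map (subtopology M D) euclidean \<phi>"
    by (simp add: continuous_map_in_subtopology)
  then have "openin (subtopology M D) {q \<in> topspace (subtopology M D). \<phi> q \<in> T}"
    using T unfolding continuous_map by simp
  moreover have "topspace (subtopology M D) = D"
    using chart_subset[OF c] by (simp add: Int_absorb1)
  ultimately show ?thesis
    using openin_trans_full[OF _ chart_openin[OF c]] by metis
qed

lemma smooth_funD:
  "smooth_fun A W f \<Longrightarrow> (D, \<phi>) \<in> A \<Longrightarrow> smooth_map_on (\<phi> ` (D \<inter> W)) (\<lambda>x. f (inv_into D \<phi> x))"
  unfolding smooth_fun_def comp_def by fast

lemma smooth_funI:
  "(\<And>D \<phi>. (D, \<phi>) \<in> A \<Longrightarrow> smooth_map_on (\<phi> ` (D \<inter> W)) (\<lambda>x. f (inv_into D \<phi> x))) \<Longrightarrow> smooth_fun A W f"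
  unfolding smooth_fun_def comp_def by fast

lemma smooth_fun_subset: "smooth_fun A W f \<Longrightarrow> V \<subseteq> W \<Longrightarrow> smooth_fun A V f"
  by (rule smooth_funI, rule smooth_map_on_subset[OF smooth_funD]) auto

lemma smooth_fun_cong:
  assumes "openin M W" "\<And>q. q \<in> W \<Longrightarrow> f q = f' q" "smooth_fun A W f"
  shows "smooth_fun A W f'"
proof (rule smooth_funI)
  fix D \<phi> assume c: "(D, \<phi>) \<in> A"
  show "smooth_map_on (\<phi> ` (D \<inter> W)) (\<lambda>x. f' (inv_into D \<phi> x))"
    by (rule smooth_map_on_cong[OF chart_image_open[OF c assms(1)] _ smooth_funD[OF assms(3) c]])
       (use assms(2) chart_inv[OF c] in auto)
qed

text \<open>Smoothness in one chart suffices, since the other charts differ from it by smooth transition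
maps.\<close>

lemma smooth_fun_chartI:
  assumes c: "(D, \<phi>) \<in> A" and W: "openin M W" "W \<subseteq> D"
    and F: "smooth_map_on (\<phi> ` W) F" and f: "\<And>q. q \<in> W \<Longrightarrow> f q = F (\<phi> q)"
  shows "smooth_fun A W f"
proof (rule smooth_funI)
  fix E \<psi> assume e: "(E, \<psi>) \<in> A"
  have o: "open (\<psi> ` (E \<inter> W))" using chart_image_open[OF e W(1)] .
  have "smooth_map_on (\<psi> ` (E \<inter> W)) (\<lambda>x. F (\<phi> (inv_into E \<psi> x)))"
  proof (rule smooth_map_on_compose[OF o _ _ _ F])
    show "open (\<phi> ` W)" using chart_image_open[OF c W(1)] W(2) by (simp add: Int_absorb1)
    show "(\<lambda>x. \<phi> (inv_into E \<psi> x)) ` \<psi> ` (E \<inter> W) \<subseteq> \<phi> ` W"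
      using chart_inv[OF e] by auto
    show "smooth_map_on (\<psi> ` (E \<inter> W)) (\<lambda>x. \<phi> (inv_into E \<psi> x))"
      by (rule smooth_map_on_subset[OF transition_smooth[OF e c]]) (use W(2) in auto)
  qed
  then show "smooth_map_on (\<psi> ` (E \<inter> W)) (\<lambda>x. f (inv_into E \<psi> x))"
    by (rule smooth_map_on_cong[OF o, rotated]) (use f chart_inv[OF e] in auto)
qed

lemma smooth_fun_const: "openin M W \<Longrightarrow> smooth_fun A W (\<lambda>q. c)"
  by (rule smooth_funI) (rule smooth_map_on_const[OF chart_image_open])

lemma smooth_fun_add:
  "openin M W \<Longrightarrow> smooth_fun A W f \<Longrightarrow> smooth_fun A W f' \<Longrightarrow> smooth_fun A W (\<lambda>q. f q + f' q)"
  by (rule smooth_funI) (rule smooth_map_on_add[OF chart_image_open smooth_funD smooth_funD])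

lemma smooth_fun_mult:
  assumes "openin M W" "smooth_fun A W f" "smooth_fun A W f'"
  shows "smooth_fun A W (\<lambda>q. f q * f' q)"
  using smooth_map_on_scaleR[OF chart_image_open[OF _ assms(1)] smooth_funD[OF assms(2)] smooth_funD[OF assms(3)]]
  by (intro smooth_funI) (simp only: real_scaleR_def)

lemma smooth_fun_diff:
  assumes "openin M W" "smooth_fun A W f" "smooth_fun A W f'"
  shows "smooth_fun A W (\<lambda>q. f q - f' q)"
  using smooth_fun_add[OF assms(1,2) smooth_fun_mult[OF assms(1) smooth_fun_const[OF assms(1), of "-1"] assms(3)]]
  by simp

lemma smooth_fun_powr:
  assumes W: "openin M W" and f: "smooth_fun A W f" and pos: "\<And>q. q \<in> W \<Longrightarrow> f q > 0"
  shows "smooth_fun A W (\<lambda>q. f q powr a)"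
proof (rule smooth_funI)
  fix D \<phi> assume c: "(D, \<phi>) \<in> A"
  show "smooth_map_on (\<phi> ` (D \<inter> W)) (\<lambda>x. f (inv_into D \<phi> x) powr a)"
    by (rule smooth_map_on_compose[OF chart_image_open[OF c W] _ _ smooth_funD[OF f c] smooth_map_on_powr])
       (use pos chart_inv[OF c] in auto)
qed

lemma smooth_fun_preimage_openin:
  assumes W: "openin M W" and f: "smooth_fun A W f" and S: "open S"
  shows "openin M {q \<in> W. f q \<in> S}"
proof (subst openin_subopen, intro ballI)
  fix q assume q: "q \<in> {q \<in> W. f q \<in> S}"
  then have "q \<in> topspace M" using W openin_subset by blast
  then obtain D \<phi> where c: "(D, \<phi>) \<in> A" "q \<in> D" by (rule chart_at)
  let ?T = "\<phi> ` (D \<inter> W) \<inter> (\<lambda>x. f (inv_into D \<phi> x)) -` S"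
  have "open ?T"
    using smooth_map_on_imp_continuous_on[OF smooth_funD[OF f c(1)]] chart_image_open[OF c(1) W] S
    by (simp add: continuous_open_preimage)
  then have "openin M {q \<in> D. \<phi> q \<in> ?T}" by (rule chart_preimage_openin[OF c(1)])
  moreover have "{q \<in> D. \<phi> q \<in> ?T} \<subseteq> {q \<in> W. f q \<in> S}"
  proof
    fix r assume "r \<in> {q \<in> D. \<phi> q \<in> ?T}"
    then show "r \<in> {q \<in> W. f q \<in> S}" using chart_mem_image_iff[OF c(1), of r W] chart_inv[OF c(1), of r] by auto
  qed
  moreover have "q \<in> {q \<in> D. \<phi> q \<in> ?T}"
    using q c chart_inv[OF c(1)] by auto
  ultimately show "\<exists>V. openin M V \<and> q \<in> V \<and> V \<subseteq> {q \<in> W. f q \<in> S}" by blast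
qed

lemma smooth_nearI: "openin M W \<Longrightarrow> p \<in> W \<Longrightarrow> smooth_fun A W f \<Longrightarrow> smooth_near M A p f"
  unfolding smooth_near_def by blast

lemma smooth_near_cong:
  assumes W: "openin M W" "p \<in> W" and eq: "\<And>q. q \<in> W \<Longrightarrow> f q = f' q"
    and f: "smooth_near M A p f"
  shows "smooth_near M A p f'"
proof -
  obtain V where V: "openin M V" "p \<in> V" "smooth_fun A V f"
    using f unfolding smooth_near_def by blast
  show ?thesis
  proof (rule smooth_nearI)
    show o: "openin M (V \<inter> W)" using V W by auto
    show "smooth_fun A (V \<inter> W) f'"
      by (rule smooth_fun_cong[OF o _ smooth_fun_subset[OF V(3)]]) (use eq in auto)
  qed (use V W in auto)
qed

lemma smooth_near_has_derivative:
  assumes f: "smooth_near M A p f" and c: "(D, \<phi>) \<in> A" and p: "p \<in> D"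
  shows "((\<lambda>x. f (inv_into D \<phi> x)) has_derivative
     frechet_derivative (\<lambda>x. f (inv_into D \<phi> x)) (at (\<phi> p))) (at (\<phi> p))"
proof -
  obtain V where V: "openin M V" "p \<in> V" "smooth_fun A V f"
    using f unfolding smooth_near_def by blast
  show ?thesis
    by (rule smooth_map_on_has_derivative[OF smooth_funD[OF V(3) c]]) (use p V in auto)
qed

section \<open>Tangent vectors in coordinates\<close>

text \<open>The directional derivative in the coordinate direction \<open>w\<close>. The value 0 on functions that are
not smooth near \<open>p\<close> agrees with the normalisation of \<open>velocity\<close>.\<close>

definition coord_vec :: "'a set \<Rightarrow> ('a \<Rightarrow> real^3) \<Rightarrow> real^3 \<Rightarrow> 'a \<Rightarrow> 'a tvec" where
  "coord_vec D \<phi> w p = (\<lambda>f. if smooth_near M A p f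
      then frechet_derivative (\<lambda>x. f (inv_into D \<phi> x)) (at (\<phi> p)) w else 0)"

lemma curve_has_derivative:
  assumes \<alpha>: "smooth_curve M A I \<alpha>" and t: "t \<in> I" and c: "(D, \<phi>) \<in> A" and "\<alpha> t \<in> D"
    and f: "smooth_near M A (\<alpha> t) f"
  shows "((\<lambda>s. f (\<alpha> s)) has_real_derivative
    coord_vec D \<phi> (frechet_derivative (\<lambda>s. \<phi> (\<alpha> s)) (at t) 1) (\<alpha> t) f) (at t)"
proof -
  define F where "F = (\<lambda>x. f (inv_into D \<phi> x))"
  have I: "open I" "continuous_map (top_of_set I) M \<alpha>"
    and sm: "smooth_map_on (I \<inter> \<alpha> -` D) (\<lambda>s. \<phi> (\<alpha> s))"
    using \<alpha> c unfolding smooth_curve_def comp_def by auto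
  have "openin (top_of_set I) {s \<in> topspace (top_of_set I). \<alpha> s \<in> D}"
    using I(2) chart_openin[OF c] unfolding continuous_map by blast
  then have o: "open {s \<in> I. \<alpha> s \<in> D}" by (simp add: openin_open_eq[OF I(1)])
  have d1: "((\<lambda>s. \<phi> (\<alpha> s)) has_derivative frechet_derivative (\<lambda>s. \<phi> (\<alpha> s)) (at t)) (at t)"
    by (rule smooth_map_on_has_derivative[OF sm]) (use t \<open>\<alpha> t \<in> D\<close> in auto)
  have d2: "(F has_derivative frechet_derivative F (at (\<phi> (\<alpha> t)))) (at (\<phi> (\<alpha> t)))"
    unfolding F_def by (rule smooth_near_has_derivative[OF f c \<open>\<alpha> t \<in> D\<close>])
  have "((\<lambda>s. F (\<phi> (\<alpha> s))) has_derivative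
      (\<lambda>v. frechet_derivative F (at (\<phi> (\<alpha> t))) (frechet_derivative (\<lambda>s. \<phi> (\<alpha> s)) (at t) v))) (at t)"
    by (rule has_derivative_compose[OF d1 d2])
  then have d: "((\<lambda>s. f (\<alpha> s)) has_derivative
      (\<lambda>v. frechet_derivative F (at (\<phi> (\<alpha> t))) (frechet_derivative (\<lambda>s. \<phi> (\<alpha> s)) (at t) v))) (at t)"
    by (rule has_derivative_transform_within_open[OF _ o])
       (use t \<open>\<alpha> t \<in> D\<close> in \<open>auto simp: F_def chart_inv[OF c]\<close>)
  have "frechet_derivative F (at (\<phi> (\<alpha> t))) (frechet_derivative (\<lambda>s. \<phi> (\<alpha> s)) (at t) v) =
      coord_vec D \<phi> (frechet_derivative (\<lambda>s. \<phi> (\<alpha> s)) (at t) 1) (\<alpha> t) f * v" for v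
  proof -
    have "frechet_derivative (\<lambda>s. \<phi> (\<alpha> s)) (at t) v = v *\<^sub>R frechet_derivative (\<lambda>s. \<phi> (\<alpha> s)) (at t) 1"
      using linear_scale[OF has_derivative_linear[OF d1], of v 1] by simp
    then show ?thesis
      using linear_scale[OF has_derivative_linear[OF d2]] f by (simp add: coord_vec_def F_def)
  qed
  with d show ?thesis
    unfolding has_field_derivative_def by simp
qed

lemma velocity_eq_coord_vec:
  assumes "smooth_curve M A I \<alpha>" "t \<in> I" "(D, \<phi>) \<in> A" "\<alpha> t \<in> D"
  shows "velocity M A \<alpha> t = coord_vec D \<phi> (frechet_derivative (\<lambda>s. \<phi> (\<alpha> s)) (at t) 1) (\<alpha> t)"
proof
  fix f
  show "velocity M A \<alpha> t f = coord_vec D \<phi> (frechet_derivative (\<lambda>s. \<phi> (\<alpha> s)) (at t) 1) (\<alpha> t) f"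
  proof (cases "smooth_near M A (\<alpha> t) f")
    case True
    then show ?thesis
      using DERIV_imp_deriv[OF curve_has_derivative[OF assms True]] by (simp add: velocity_def comp_def)
  qed (simp add: velocity_def coord_vec_def)
qed

text \<open>Straight lines in a chart realise every coordinate direction as a velocity.\<close>

lemma smooth_curve_coordinate_line:
  assumes c: "(D, \<phi>) \<in> A" and p: "p \<in> D"
  obtains e where "e > 0" "smooth_curve M A {-e<..<e} (\<lambda>t. inv_into D \<phi> (\<phi> p + t *\<^sub>R w))"
    "\<And>t. t \<in> {-e<..<e} \<Longrightarrow> \<phi> p + t *\<^sub>R w \<in> \<phi> ` D"
proof -
  obtain r where r: "r > 0" "ball (\<phi> p) r \<subseteq> \<phi> ` D"
    using chart_open_image[OF c] p by (meson imageI open_contains_ball)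
  \<comment> \<open>For \<open>\<bar>t\<bar> < e\<close> the point stays within \<open>r\<close> of \<open>\<phi> p\<close>; the summand 1 covers \<open>w = 0\<close>.\<close>
  define e where "e = r / (norm w + 1)"
  have e: "e > 0" using r(1) unfolding e_def by (simp add: add_nonneg_pos)
  have inD: "\<phi> p + t *\<^sub>R w \<in> \<phi> ` D" if "t \<in> {-e<..<e}" for t
  proof -
    have "\<bar>t\<bar> * norm w \<le> \<bar>t\<bar> * (norm w + 1)" by (simp add: mult_left_mono)
    also have "\<bar>t\<bar> * (norm w + 1) < e * (norm w + 1)"
      using that by (intro mult_strict_right_mono) (auto simp: add_nonneg_pos)
    also have "\<dots> = r" unfolding e_def using add_nonneg_pos[of "norm w" 1] by simp
    finally have "\<phi> p + t *\<^sub>R w \<in> ball (\<phi> p) r" by (simp add: dist_norm)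
    then show ?thesis using r(2) by blast
  qed
  let ?l = "\<lambda>t. \<phi> p + t *\<^sub>R w" and ?a = "\<lambda>t. inv_into D \<phi> (\<phi> p + t *\<^sub>R w)"
  have l: "smooth_map_on T ?l" if "open T" for T
    using that
    by (intro smooth_map_on_add smooth_map_on_const smooth_map_on_scaleR smooth_map_on_id)
  \<comment> \<open>Preimages are computed in the chart, which gives continuity and the domains for smoothness.\<close>
  have pre: "{t \<in> {-e<..<e}. ?a t \<in> V} = {t \<in> {-e<..<e}. ?l t \<in> \<phi> ` (D \<inter> V)}" for V
  proof -
    have "?a t \<in> V \<longleftrightarrow> ?l t \<in> \<phi> ` (D \<inter> V)" if t: "t \<in> {-e<..<e}" for t
    proof -
      obtain q where q: "q \<in> D" "?l t = \<phi> q" using inD[OF t] by auto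
      show ?thesis
        unfolding q(2) chart_inv[OF c q(1)] chart_mem_image_iff[OF c q(1)] by (rule refl)
    qed
    then show ?thesis by blast
  qed
  have o: "open {t \<in> {-e<..<e}. ?a t \<in> V}" if "openin M V" for V
  proof -
    have "open ({-e<..<e} \<inter> ?l -` (\<phi> ` (D \<inter> V)))"
      using smooth_map_on_imp_continuous_on[OF l[of "{-e<..<e}"]] chart_image_open[OF c that]
      by (intro continuous_open_preimage) auto
    then show ?thesis unfolding pre by (simp add: Int_def)
  qed
  have cont: "continuous_map (top_of_set {-e<..<e}) M ?a"
  proof -
    have "?a t \<in> topspace M" if "t \<in> {-e<..<e}" for t
      using inv_into_into[OF inD[OF that]] chart_subset[OF c] by auto
    moreover have "openin (top_of_set {-e<..<e}) {t \<in> {-e<..<e}. ?a t \<in> V}" if "openin M V" for V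
      using o[OF that] by (subst openin_open_eq) auto
    ultimately show ?thesis
      unfolding continuous_map by auto
  qed
  have sm: "smooth_map_on ({-e<..<e} \<inter> ?a -` E) (\<psi> \<circ> ?a)" if e': "(E, \<psi>) \<in> A" for E \<psi>
  proof -
    let ?I = "{-e<..<e} \<inter> ?a -` E"
    have I: "?I = {t \<in> {-e<..<e}. ?a t \<in> E}" by blast
    have oI: "open ?I" unfolding I by (rule o[OF chart_openin[OF e']])
    have "smooth_map_on ?I (\<lambda>t. \<psi> (inv_into D \<phi> (?l t)))"
      by (rule smooth_map_on_compose[OF oI chart_image_open[OF c chart_openin[OF e']] _ l[OF oI] transition_smooth[OF c e']])
         (use pre[of E] in blast)
    then show "smooth_map_on ?I (\<psi> \<circ> ?a)" by (simp add: comp_def)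
  qed
  have "smooth_curve M A {-e<..<e} ?a"
    unfolding smooth_curve_def using cont sm by auto
  with e inD show thesis by (intro that)
qed

text \<open>A chart identifies \<open>\<real>\<^sup>3\<close> with the tangent space. Together with the linearity of \<open>coord_vec\<close> in
\<open>w\<close> and its injectivity, shown next, this makes tangent spaces 3-dimensional vector spaces.\<close>

lemma tangent_space_eq_range_coord_vec:
  assumes c: "(D, \<phi>) \<in> A" and p: "p \<in> D"
  shows "tangent_space M A p = range (\<lambda>w. coord_vec D \<phi> w p)"
proof
  show "tangent_space M A p \<subseteq> range (\<lambda>w. coord_vec D \<phi> w p)"
  proof
    fix v assume "v \<in> tangent_space M A p"
    then obtain \<alpha> e where \<alpha>: "v = velocity M A \<alpha> 0" "\<alpha> 0 = p" "e > 0" "smooth_curve M A {-e<..<e} \<alpha>"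
      unfolding tangent_space_def by blast
    have "v = coord_vec D \<phi> (frechet_derivative (\<lambda>s. \<phi> (\<alpha> s)) (at 0) 1) (\<alpha> 0)"
      unfolding \<alpha>(1) by (rule velocity_eq_coord_vec[OF \<alpha>(4) _ c]) (use \<alpha> p in auto)
    then show "v \<in> range (\<lambda>w. coord_vec D \<phi> w p)" using \<alpha>(2) by blast
  qed
  show "range (\<lambda>w. coord_vec D \<phi> w p) \<subseteq> tangent_space M A p"
  proof clarify
    fix w
    obtain e where e: "e > 0" "smooth_curve M A {-e<..<e} (\<lambda>t. inv_into D \<phi> (\<phi> p + t *\<^sub>R w))"
      and inD: "\<And>t. t \<in> {-e<..<e} \<Longrightarrow> \<phi> p + t *\<^sub>R w \<in> \<phi> ` D"
      using smooth_curve_coordinate_line[OF c p] by blast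
    let ?a = "\<lambda>t. inv_into D \<phi> (\<phi> p + t *\<^sub>R w)"
    have a0: "?a 0 = p" using chart_inv[OF c p] by simp
    have "((\<lambda>t. \<phi> p + t *\<^sub>R w) has_derivative (\<lambda>t. t *\<^sub>R w)) (at 0)"
      by (auto intro!: derivative_eq_intros)
    then have "((\<lambda>t. \<phi> (?a t)) has_derivative (\<lambda>t. t *\<^sub>R w)) (at 0)"
      by (rule has_derivative_transform_within_open[of _ _ _ _ "{-e<..<e}"])
         (use e(1) f_inv_into_f[OF inD] in auto)
    from frechet_derivative_at[OF this]
    have "frechet_derivative (\<lambda>t. \<phi> (?a t)) (at 0) 1 = w" by (metis scaleR_one)
    then have "velocity M A ?a 0 = coord_vec D \<phi> w p"
      using velocity_eq_coord_vec[OF e(2) _ c, of 0] e(1) a0 p by simp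
    then show "coord_vec D \<phi> w p \<in> tangent_space M A p"
      unfolding tangent_space_def using a0 e by (intro CollectI exI[of _ ?a]) auto
  qed
qed

lemma coord_vec_add:
  assumes c: "(D, \<phi>) \<in> A" and p: "p \<in> D"
  shows "coord_vec D \<phi> (u + v) p = coord_vec D \<phi> u p +\<^sub>T coord_vec D \<phi> v p"
  using linear_add[OF has_derivative_linear[OF smooth_near_has_derivative[OF _ c p]]]
  by (auto simp: coord_vec_def tv_add_def)

lemma coord_vec_scale:
  assumes c: "(D, \<phi>) \<in> A" and p: "p \<in> D"
  shows "coord_vec D \<phi> (a *\<^sub>R u) p = a *\<^sub>T coord_vec D \<phi> u p"
  using linear_scale[OF has_derivative_linear[OF smooth_near_has_derivative[OF _ c p]]]
  by (auto simp: coord_vec_def tv_scale_def)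

lemma coord_vec_zero:
  assumes c: "(D, \<phi>) \<in> A" and p: "p \<in> D"
  shows "coord_vec D \<phi> 0 p = tv_zero"
  using coord_vec_scale[OF assms, of 0 0] by (simp add: tv_scale_def tv_zero_def)

text \<open>The coordinate functions of the chart recover \<open>w\<close>.\<close>

lemma coord_vec_eq_zeroD:
  assumes c: "(D, \<phi>) \<in> A" and p: "p \<in> D" and z: "coord_vec D \<phi> w p = tv_zero"
  shows "w = 0"
proof -
  have "w $ i = 0" for i
  proof -
    let ?f = "\<lambda>q. \<phi> q $ i"
    have L: "bounded_linear (\<lambda>x::real^3. x $ i)" by (rule bounded_linear_vec_nth)
    have o: "open (\<phi> ` D)" using chart_open_image[OF c] .
    have "smooth_fun A D ?f"
      by (rule smooth_fun_chartI[OF c chart_openin[OF c] subset_refl, where F = "\<lambda>x. x $ i"])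
         (auto intro: smooth_map_on_linear[OF L o smooth_map_on_id[OF o]])
    then have f: "smooth_near M A p ?f" by (rule smooth_nearI[OF chart_openin[OF c] p])
    have "((\<lambda>x. x $ i) has_derivative (\<lambda>x. x $ i)) (at (\<phi> p))"
      by (rule bounded_linear_imp_has_derivative[OF L])
    then have "((\<lambda>x. \<phi> (inv_into D \<phi> x) $ i) has_derivative (\<lambda>x. x $ i)) (at (\<phi> p))"
      by (rule has_derivative_transform_within_open[OF _ o]) (use p in \<open>simp_all add: f_inv_into_f\<close>)
    from frechet_derivative_at[OF this]
    have "frechet_derivative (\<lambda>x. \<phi> (inv_into D \<phi> x) $ i) (at (\<phi> p)) = (\<lambda>x. x $ i)" ..
    then have "coord_vec D \<phi> w p ?f = w $ i" using f by (simp add: coord_vec_def)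
    then show ?thesis using z by (simp add: tv_zero_def)
  qed
  then show ?thesis by (simp add: vec_eq_iff)
qed

lemma tangent_zero: "p \<in> topspace M \<Longrightarrow> tv_zero \<in> tangent_space M A p"
  by (metis chart_at tangent_space_eq_range_coord_vec coord_vec_zero rangeI)

lemma tangent_add:
  assumes "p \<in> topspace M" "u \<in> tangent_space M A p" "v \<in> tangent_space M A p"
  shows "u +\<^sub>T v \<in> tangent_space M A p"
proof -
  obtain D \<phi> where c: "(D, \<phi>) \<in> A" "p \<in> D" using chart_at[OF assms(1)] .
  then show ?thesis
    using assms(2,3) coord_vec_add[OF c, symmetric] by (auto simp: tangent_space_eq_range_coord_vec[OF c])
qed

lemma tangent_scale:
  assumes "p \<in> topspace M" "u \<in> tangent_space M A p"
  shows "a *\<^sub>T u \<in> tangent_space M A p"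
proof -
  obtain D \<phi> where c: "(D, \<phi>) \<in> A" "p \<in> D" using chart_at[OF assms(1)] .
  then show ?thesis
    using assms(2) coord_vec_scale[OF c, symmetric] by (auto simp: tangent_space_eq_range_coord_vec[OF c])
qed

lemma tv_diff_eq: "u -\<^sub>T v = u +\<^sub>T (- 1) *\<^sub>T v"
  by (simp add: tv_diff_def tv_add_def tv_scale_def)

lemma tangent_diff:
  "p \<in> topspace M \<Longrightarrow> u \<in> tangent_space M A p \<Longrightarrow> v \<in> tangent_space M A p \<Longrightarrow> u -\<^sub>T v \<in> tangent_space M A p"
  unfolding tv_diff_eq by (intro tangent_add tangent_scale)

lemma tangent_not_smooth:
  assumes "p \<in> topspace M" "v \<in> tangent_space M A p" "\<not> smooth_near M A p f"
  shows "v f = 0"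
proof -
  obtain D \<phi> where c: "(D, \<phi>) \<in> A" "p \<in> D" using chart_at[OF assms(1)] .
  then show ?thesis
    using assms(2,3) by (auto simp: tangent_space_eq_range_coord_vec[OF c] coord_vec_def)
qed

lemma smooth_near_diff:
  assumes "smooth_near M A p f" "smooth_near M A p f'"
  shows "smooth_near M A p (\<lambda>q. f q - f' q)"
proof -
  obtain V V' where V: "openin M V" "p \<in> V" "smooth_fun A V f" "openin M V'" "p \<in> V'" "smooth_fun A V' f'"
    using assms unfolding smooth_near_def by blast
  have o: "openin M (V \<inter> V')" using V by auto
  then have "smooth_fun A (V \<inter> V') (\<lambda>q. f q - f' q)"
    using V by (intro smooth_fun_diff) (auto intro: smooth_fun_subset)
  then show ?thesis
    using V o by (intro smooth_nearI[of "V \<inter> V'"]) auto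
qed

lemma tangent_diff_fun:
  assumes "p \<in> topspace M" "v \<in> tangent_space M A p" "smooth_near M A p f" "smooth_near M A p f'"
  shows "v (\<lambda>q. f q - f' q) = v f - v f'"
proof -
  obtain D \<phi> where c: "(D, \<phi>) \<in> A" "p \<in> D" using chart_at[OF assms(1)] .
  have "frechet_derivative (\<lambda>x. f (inv_into D \<phi> x) - f' (inv_into D \<phi> x)) (at (\<phi> p)) =
    (\<lambda>w. frechet_derivative (\<lambda>x. f (inv_into D \<phi> x)) (at (\<phi> p)) w -
         frechet_derivative (\<lambda>x. f' (inv_into D \<phi> x)) (at (\<phi> p)) w)"
    by (rule frechet_derivative_at[symmetric])
       (intro has_derivative_diff smooth_near_has_derivative[OF _ c] assms)
  then show ?thesis
    using assms(2-4) smooth_near_diff[OF assms(3,4)]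
    by (auto simp: tangent_space_eq_range_coord_vec[OF c] coord_vec_def)
qed

lemma tangent_const:
  assumes "p \<in> topspace M" "v \<in> tangent_space M A p"
  shows "v (\<lambda>q. a) = 0"
proof -
  obtain D \<phi> where c: "(D, \<phi>) \<in> A" "p \<in> D" using chart_at[OF assms(1)] .
  then show ?thesis
    using assms(2) by (auto simp: tangent_space_eq_range_coord_vec[OF c] coord_vec_def)
qed

text \<open>Tangent vectors are local; if neither function is smooth near the point, both values are the
default 0.\<close>

lemma tangent_cong:
  assumes W: "openin M W" "p \<in> W" and v: "v \<in> tangent_space M A p" and eq: "\<And>q. q \<in> W \<Longrightarrow> f q = f' q"
  shows "v f = v f'"
proof -
  have p: "p \<in> topspace M" using W openin_subset by blast
  show ?thesis
  proof (cases "smooth_near M A p f")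
    case True
    then have True': "smooth_near M A p f'" using smooth_near_cong[OF W, of f f'] eq by blast
    obtain D \<phi> where c: "(D, \<phi>) \<in> A" "p \<in> D" using chart_at[OF p] .
    have "frechet_derivative (\<lambda>x. f (inv_into D \<phi> x)) (at (\<phi> p)) =
      frechet_derivative (\<lambda>x. f' (inv_into D \<phi> x)) (at (\<phi> p))"
    proof (rule frechet_derivative_at)
      show "((\<lambda>x. f' (inv_into D \<phi> x)) has_derivative
          frechet_derivative (\<lambda>x. f (inv_into D \<phi> x)) (at (\<phi> p))) (at (\<phi> p))"
        by (rule has_derivative_transform_within_open[OF smooth_near_has_derivative[OF True c]
            chart_image_open[OF c(1) W(1)]])
           (use eq c W chart_inv[OF c(1)] in auto)
    qed
    then show ?thesis
      using v True True' by (auto simp: tangent_space_eq_range_coord_vec[OF c] coord_vec_def)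
  next
    case False
    moreover have "\<not> smooth_near M A p f'"
      using False smooth_near_cong[OF W, of f' f] eq by auto
    ultimately show ?thesis using tangent_not_smooth[OF p v] by simp
  qed
qed

section \<open>Smooth vector fields\<close>

lemma vfield_tangent: "smooth_vfield M A W X \<Longrightarrow> p \<in> W \<Longrightarrow> X p \<in> tangent_space M A p"
  unfolding smooth_vfield_def by blast

lemma vfield_smooth_fun:
  "smooth_vfield M A W X \<Longrightarrow> openin M V \<Longrightarrow> V \<subseteq> W \<Longrightarrow> smooth_fun A V f \<Longrightarrow> smooth_fun A V (\<lambda>q. X q f)"
  unfolding smooth_vfield_def by blast

lemma vfield_smooth_near:
  assumes "smooth_vfield M A W X" "openin M W" "p \<in> W" "smooth_near M A p f"
  shows "smooth_near M A p (\<lambda>q. X q f)"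
proof -
  obtain V where V: "openin M V" "p \<in> V" "smooth_fun A V f"
    using assms(4) unfolding smooth_near_def by blast
  then have "openin M (V \<inter> W)" using assms(2) by auto
  then show ?thesis
    using V assms by (intro smooth_nearI[of "V \<inter> W"] vfield_smooth_fun[of W X])
      (auto intro: smooth_fun_subset)
qed

lemma smooth_vfield_subset: "smooth_vfield M A W X \<Longrightarrow> V \<subseteq> W \<Longrightarrow> smooth_vfield M A V X"
  unfolding smooth_vfield_def by blast

lemma smooth_vfield_cong:
  assumes "openin M W" "\<And>q. q \<in> W \<Longrightarrow> X q = Y q" "smooth_vfield M A W X"
  shows "smooth_vfield M A W Y"
  unfolding smooth_vfield_def
proof (intro conjI ballI allI impI)
  show "Y q \<in> tangent_space M A q" if "q \<in> W" for q
    using assms(2,3) that vfield_tangent by metis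
  fix V f assume V: "openin M V \<and> V \<subseteq> W \<and> smooth_fun A V f"
  show "smooth_fun A V (\<lambda>q. Y q f)"
    by (rule smooth_fun_cong[of V "\<lambda>q. X q f"])
       (use V assms(2) vfield_smooth_fun[OF assms(3)] in auto)
qed

lemma smooth_vfield_add:
  assumes W: "openin M W" and X: "smooth_vfield M A W X" and Y: "smooth_vfield M A W Y"
  shows "smooth_vfield M A W (\<lambda>q. X q +\<^sub>T Y q)"
  unfolding smooth_vfield_def
proof (intro conjI ballI allI impI)
  show "X q +\<^sub>T Y q \<in> tangent_space M A q" if "q \<in> W" for q
    using that openin_subset[OF W] by (intro tangent_add vfield_tangent[OF X] vfield_tangent[OF Y]) auto
  show "smooth_fun A V (\<lambda>q. (X q +\<^sub>T Y q) f)" if "openin M V \<and> V \<subseteq> W \<and> smooth_fun A V f" for V f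
    unfolding tv_add_def using that vfield_smooth_fun[OF X] vfield_smooth_fun[OF Y]
    by (intro smooth_fun_add) auto
qed

lemma smooth_vfield_scale:
  assumes W: "openin M W" and X: "smooth_vfield M A W X" and h: "smooth_fun A W h"
  shows "smooth_vfield M A W (\<lambda>q. h q *\<^sub>T X q)"
  unfolding smooth_vfield_def
proof (intro conjI ballI allI impI)
  show "h q *\<^sub>T X q \<in> tangent_space M A q" if "q \<in> W" for q
    using that openin_subset[OF W] by (intro tangent_scale vfield_tangent[OF X]) auto
  show "smooth_fun A V (\<lambda>q. (h q *\<^sub>T X q) f)" if "openin M V \<and> V \<subseteq> W \<and> smooth_fun A V f" for V f
    unfolding tv_scale_def using that vfield_smooth_fun[OF X] smooth_fun_subset[OF h]
    by (intro smooth_fun_mult) auto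
qed

lemma smooth_vfield_diff:
  assumes W: "openin M W" and X: "smooth_vfield M A W X" and Y: "smooth_vfield M A W Y"
  shows "smooth_vfield M A W (\<lambda>q. X q -\<^sub>T Y q)"
  unfolding tv_diff_eq
  by (intro smooth_vfield_add smooth_vfield_scale smooth_fun_const assms)

lemma smooth_vfield_zero: "openin M W \<Longrightarrow> smooth_vfield M A W (\<lambda>q. tv_zero)"
  unfolding smooth_vfield_def using openin_subset[of M W]
  by (auto intro!: tangent_zero) (simp add: smooth_fun_const tv_zero_def)

lemma smooth_vfield_coord_vec:
  assumes c: "(D, \<phi>) \<in> A"
  shows "smooth_vfield M A D (coord_vec D \<phi> w)"
  unfolding smooth_vfield_def
proof (intro conjI ballI allI impI)
  show "coord_vec D \<phi> w q \<in> tangent_space M A q" if "q \<in> D" for q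
    using tangent_space_eq_range_coord_vec[OF c that] by blast
  fix V f assume V: "openin M V \<and> V \<subseteq> D \<and> smooth_fun A V f"
  then have "smooth_map_on (\<phi> ` V) (\<lambda>x. f (inv_into D \<phi> x))"
    using smooth_funD[of V f, OF _ c] by (simp add: Int_absorb1)
  then have "smooth_map_on (\<phi> ` V) (\<lambda>x. frechet_derivative (\<lambda>x. f (inv_into D \<phi> x)) (at x) w)"
    by (rule smooth_map_on_derivative)
  then show "smooth_fun A V (\<lambda>q. coord_vec D \<phi> w q f)"
    by (rule smooth_fun_chartI[OF c, rotated 2])
       (use V smooth_nearI in \<open>auto simp: coord_vec_def\<close>)
qed

text \<open>The field along its integral curve is the derivative in the curve parameter. This turns
equations between derivatives \<open>k f\<close> into ordinary differential equations.\<close>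

lemma integral_curve_has_derivative:
  assumes \<gamma>: "integral_curve M A U k J \<gamma>" and t: "t \<in> J"
    and W: "openin M W" "\<gamma> t \<in> W" "smooth_fun A W f"
  shows "((\<lambda>s. f (\<gamma> s)) has_real_derivative k (\<gamma> t) f) (at t)"
proof -
  have c: "smooth_curve M A J \<gamma>" and k: "k (\<gamma> t) = velocity M A \<gamma> t"
    using \<gamma> t unfolding integral_curve_def by auto
  have "\<gamma> t \<in> topspace M" using W openin_subset by blast
  then obtain D \<phi> where D: "(D, \<phi>) \<in> A" "\<gamma> t \<in> D" by (rule chart_at)
  show ?thesis
    unfolding k velocity_eq_coord_vec[OF c t D]
    by (rule curve_has_derivative[OF c t D smooth_nearI[OF W]])
qed

end

section \<open>Orthonormal triples and traces\<close>

lemma tv_scale_one: "1 *\<^sub>T u = u"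
  by (simp add: tv_scale_def)

lemma tv_scale_zero: "0 *\<^sub>T u = tv_zero"
  by (simp add: tv_scale_def tv_zero_def)

lemma tv_add_zero: "u +\<^sub>T tv_zero = u" "tv_zero +\<^sub>T u = u"
  by (simp_all add: tv_add_def tv_zero_def)

locale riemannian3 = manifold3 +
  fixes g :: "'a metric"
  assumes metric: "riemannian_metric M A g"
begin

abbreviation T :: "'a \<Rightarrow> 'a tvec set" where
  "T p \<equiv> tangent_space M A p"

abbreviation vfield :: "'a set \<Rightarrow> 'a vfield \<Rightarrow> bool" where
  "vfield W X \<equiv> smooth_vfield M A W X"

lemma g_sym: "p \<in> topspace M \<Longrightarrow> u \<in> T p \<Longrightarrow> v \<in> T p \<Longrightarrow> g p u v = g p v u"
  and g_pos: "p \<in> topspace M \<Longrightarrow> u \<in> T p \<Longrightarrow> u \<noteq> tv_zero \<Longrightarrow> g p u u > 0"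
  and g_lin: "p \<in> topspace M \<Longrightarrow> u \<in> T p \<Longrightarrow> v \<in> T p \<Longrightarrow> w \<in> T p \<Longrightarrow>
     g p (a *\<^sub>T u +\<^sub>T b *\<^sub>T v) w = a * g p u w + b * g p v w"
  and g_smooth: "openin M W \<Longrightarrow> vfield W X \<Longrightarrow> vfield W Y \<Longrightarrow> smooth_fun A W (\<lambda>p. g p (X p) (Y p))"
  using metric unfolding riemannian_metric_def by blast+

lemma g_add_left: "p \<in> topspace M \<Longrightarrow> u \<in> T p \<Longrightarrow> v \<in> T p \<Longrightarrow> w \<in> T p \<Longrightarrow>
    g p (u +\<^sub>T v) w = g p u w + g p v w"
  using g_lin[of p u v w 1 1] by (simp add: tv_scale_one)

lemma g_scale_left: "p \<in> topspace M \<Longrightarrow> u \<in> T p \<Longrightarrow> w \<in> T p \<Longrightarrow> g p (a *\<^sub>T u) w = a * g p u w"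
  using g_lin[of p u u w a 0] by (simp add: tv_scale_zero tv_add_zero)

lemma g_zero_left: "p \<in> topspace M \<Longrightarrow> w \<in> T p \<Longrightarrow> g p tv_zero w = 0"
  using g_scale_left[of p tv_zero w 0] tangent_zero by (simp add: tv_scale_zero)

lemma g_diff_left: "p \<in> topspace M \<Longrightarrow> u \<in> T p \<Longrightarrow> v \<in> T p \<Longrightarrow> w \<in> T p \<Longrightarrow>
    g p (u -\<^sub>T v) w = g p u w - g p v w"
  by (simp add: tv_diff_eq g_add_left g_scale_left tangent_scale)

lemma g_add_right: "p \<in> topspace M \<Longrightarrow> u \<in> T p \<Longrightarrow> v \<in> T p \<Longrightarrow> w \<in> T p \<Longrightarrow>
    g p w (u +\<^sub>T v) = g p w u + g p w v"
  by (simp add: g_sym[of p w] g_add_left tangent_add)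

lemma g_scale_right: "p \<in> topspace M \<Longrightarrow> u \<in> T p \<Longrightarrow> w \<in> T p \<Longrightarrow> g p w (a *\<^sub>T u) = a * g p w u"
  by (simp add: g_sym[of p w] g_scale_left tangent_scale)

lemma g_zero_right: "p \<in> topspace M \<Longrightarrow> w \<in> T p \<Longrightarrow> g p w tv_zero = 0"
  by (simp add: g_sym[of p w] g_zero_left tangent_zero)

lemma g_diff_right: "p \<in> topspace M \<Longrightarrow> u \<in> T p \<Longrightarrow> v \<in> T p \<Longrightarrow> w \<in> T p \<Longrightarrow>
    g p w (u -\<^sub>T v) = g p w u - g p w v"
  by (simp add: g_sym[of p w] g_diff_left tangent_diff)

lemmas g_simps = g_add_left g_scale_left g_diff_left g_zero_left
  g_add_right g_scale_right g_diff_right g_zero_right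
  tangent_add tangent_scale tangent_diff tangent_zero

definition orthonormal3 :: "'a \<Rightarrow> 'a tvec \<Rightarrow> 'a tvec \<Rightarrow> 'a tvec \<Rightarrow> bool" where
  "orthonormal3 p a b c \<longleftrightarrow> p \<in> topspace M \<and> a \<in> T p \<and> b \<in> T p \<and> c \<in> T p \<and>
     g p a a = 1 \<and> g p b b = 1 \<and> g p c c = 1 \<and> g p a b = 0 \<and> g p a c = 0 \<and> g p b c = 0"

lemma orthonormal3D:
  assumes "orthonormal3 p a b c"
  shows "p \<in> topspace M" "a \<in> T p" "b \<in> T p" "c \<in> T p"
    "g p a a = 1" "g p b b = 1" "g p c c = 1" "g p a b = 0" "g p a c = 0" "g p b c = 0"
    "g p b a = 0" "g p c a = 0" "g p c b = 0"
  using assms g_sym[of p] unfolding orthonormal3_def by auto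

text \<open>The linear map from \<open>\<real>\<^sup>3\<close> given by the coordinate directions of \<open>a, b, c\<close> is injective by
orthonormality, hence surjective for reasons of dimension.\<close>

lemma orthonormal3_expand:
  assumes o: "orthonormal3 p a b c" and v: "v \<in> T p"
  shows "v = g p v a *\<^sub>T a +\<^sub>T g p v b *\<^sub>T b +\<^sub>T g p v c *\<^sub>T c"
proof -
  note o' = orthonormal3D[OF o]
  obtain D \<phi> where ch: "(D, \<phi>) \<in> A" "p \<in> D" using chart_at[OF o'(1)] .
  note Teq = tangent_space_eq_range_coord_vec[OF ch]
  obtain wa wb wc w where w: "a = coord_vec D \<phi> wa p" "b = coord_vec D \<phi> wb p" "c = coord_vec D \<phi> wc p"
      "v = coord_vec D \<phi> w p"
    using o'(2-4) v unfolding Teq by blast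
  define L where "L = (\<lambda>s::real^3. s $ 1 *\<^sub>R wa + s $ 2 *\<^sub>R wb + s $ 3 *\<^sub>R wc)"
  have lin: "linear L"
    by (rule linearI) (simp_all add: L_def algebra_simps)
  have cL: "coord_vec D \<phi> (L s) p = s $ 1 *\<^sub>T a +\<^sub>T s $ 2 *\<^sub>T b +\<^sub>T s $ 3 *\<^sub>T c" for s
    by (simp add: L_def coord_vec_add[OF ch] coord_vec_scale[OF ch] w)
  have gL: "g p (s $ 1 *\<^sub>T a +\<^sub>T s $ 2 *\<^sub>T b +\<^sub>T s $ 3 *\<^sub>T c) a = s $ 1"
    "g p (s $ 1 *\<^sub>T a +\<^sub>T s $ 2 *\<^sub>T b +\<^sub>T s $ 3 *\<^sub>T c) b = s $ 2"
    "g p (s $ 1 *\<^sub>T a +\<^sub>T s $ 2 *\<^sub>T b +\<^sub>T s $ 3 *\<^sub>T c) c = s $ 3" for s :: "real^3"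
    by (simp_all add: g_simps o')
  have "inj L"
  proof (rule linear_injective_0[THEN iffD2, OF lin], intro allI impI)
    fix s assume "L s = 0"
    then have z: "s $ 1 *\<^sub>T a +\<^sub>T s $ 2 *\<^sub>T b +\<^sub>T s $ 3 *\<^sub>T c = tv_zero"
      using cL[of s] coord_vec_zero[OF ch] by simp
    show "s = 0"
      using gL[of s] unfolding z by (simp add: g_zero_left o' vec_eq_iff forall_3)
  qed
  then have "surj L" by (rule linear_inj_imp_surj[OF lin])
  then obtain s where "w = L s" by (meson surjD)
  then have "v = s $ 1 *\<^sub>T a +\<^sub>T s $ 2 *\<^sub>T b +\<^sub>T s $ 3 *\<^sub>T c" using w(4) cL by simp
  then show ?thesis using gL[of s] by simp
qed

lemma orthonormal3_inner:
  assumes o: "orthonormal3 p a b c" and u: "u \<in> T p" and v: "v \<in> T p"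
  shows "g p u v = g p u a * g p v a + g p u b * g p v b + g p u c * g p v c"
proof -
  note o' = orthonormal3D[OF o]
  have "g p u v = g p u (g p v a *\<^sub>T a +\<^sub>T g p v b *\<^sub>T b +\<^sub>T g p v c *\<^sub>T c)"
    using orthonormal3_expand[OF o v] by simp
  then show ?thesis by (simp add: g_simps o' u mult.commute)
qed

definition tv_linear :: "'a \<Rightarrow> ('a tvec \<Rightarrow> 'a tvec) \<Rightarrow> bool" where
  "tv_linear p L \<longleftrightarrow> (\<forall>u\<in>T p. L u \<in> T p) \<and>
     (\<forall>u\<in>T p. \<forall>v\<in>T p. \<forall>a b. L (a *\<^sub>T u +\<^sub>T b *\<^sub>T v) = a *\<^sub>T L u +\<^sub>T b *\<^sub>T L v)"

lemma tv_linear_expand: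
  assumes L: "tv_linear p L" and o: "orthonormal3 p a b c" and u: "u \<in> T p"
  shows "L u = g p u a *\<^sub>T L a +\<^sub>T g p u b *\<^sub>T L b +\<^sub>T g p u c *\<^sub>T L c"
proof -
  note o' = orthonormal3D[OF o]
  have lin: "L (\<alpha> *\<^sub>T v +\<^sub>T \<beta> *\<^sub>T w) = \<alpha> *\<^sub>T L v +\<^sub>T \<beta> *\<^sub>T L w" if "v \<in> T p" "w \<in> T p" for v w \<alpha> \<beta>
    using L that unfolding tv_linear_def by blast
  \<comment> \<open>The factor 1 fits the sum of three to the two-term form of linearity.\<close>
  have "L u = L (1 *\<^sub>T (g p u a *\<^sub>T a +\<^sub>T g p u b *\<^sub>T b) +\<^sub>T g p u c *\<^sub>T c)"
    using orthonormal3_expand[OF o u] by (simp add: tv_scale_one)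
  also have "\<dots> = L (g p u a *\<^sub>T a +\<^sub>T g p u b *\<^sub>T b) +\<^sub>T g p u c *\<^sub>T L c"
    by (subst lin) (simp_all add: o' tangent_add tangent_scale tv_scale_one)
  finally show ?thesis by (simp add: lin o')
qed

text \<open>Expand the primed vectors in the unprimed ones; the products of coefficients, summed over the
primed triple, are inner products of the unprimed one by \<open>orthonormal3_inner\<close>.\<close>

lemma trace_orthonormal3:
  assumes L: "tv_linear p L" and o: "orthonormal3 p a b c" and o2: "orthonormal3 p a' b' c'"
  shows "g p (L a') a' + g p (L b') b' + g p (L c') c' = g p (L a) a + g p (L b) b + g p (L c) c"
proof -
  note o' = orthonormal3D[OF o] and o2' = orthonormal3D[OF o2]
  have LT: "L u \<in> T p" if "u \<in> T p" for u using L that unfolding tv_linear_def by blast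
  define B where "B = (\<lambda>i j. g p (L i) j)"
  have q: "g p (L u) u =
      (g p u a * g p u a) * B a a + (g p u a * g p u b) * B a b + (g p u a * g p u c) * B a c +
      (g p u b * g p u a) * B b a + (g p u b * g p u b) * B b b + (g p u b * g p u c) * B b c +
      (g p u c * g p u a) * B c a + (g p u c * g p u b) * B c b + (g p u c * g p u c) * B c c"
    if u: "u \<in> T p" for u
  proof -
    have "g p (L u) u = g p (L u) a * g p u a + g p (L u) b * g p u b + g p (L u) c * g p u c"
      using orthonormal3_inner[OF o LT[OF u] u] .
    moreover have "g p (L u) w = g p u a * B a w + g p u b * B b w + g p u c * B c w" if w: "w \<in> T p" for w
      unfolding tv_linear_expand[OF L o u] B_def by (simp add: g_simps o' LT w)
    ultimately show ?thesis using o' by (simp add: algebra_simps)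
  qed
  \<comment> \<open>Each tangent vector has the same inner products in both triples; applied to the unprimed vectors
    this says that the matrix of coefficients is orthogonal.\<close>
  have S: "g p a' i * g p a' j + g p b' i * g p b' j + g p c' i * g p c' j = g p i j"
    if "i \<in> T p" "j \<in> T p" for i j
    using orthonormal3_inner[OF o2 that] g_sym[OF o'(1)] that o2' by metis
  have "g p (L a') a' + g p (L b') b' + g p (L c') c' =
      g p a a * B a a + g p a b * B a b + g p a c * B a c +
      g p b a * B b a + g p b b * B b b + g p b c * B b c +
      g p c a * B c a + g p c b * B c b + g p c c * B c c"
    unfolding q[OF o2'(2)] q[OF o2'(3)] q[OF o2'(4)]
    unfolding S[OF o'(2) o'(2), symmetric] S[OF o'(2) o'(3), symmetric] S[OF o'(2) o'(4), symmetric]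
     S[OF o'(3) o'(2), symmetric] S[OF o'(3) o'(3), symmetric] S[OF o'(3) o'(4), symmetric]
     S[OF o'(4) o'(2), symmetric] S[OF o'(4) o'(3), symmetric] S[OF o'(4) o'(4), symmetric]
    by (simp add: distrib_right)
  then show ?thesis by (simp add: o' B_def)
qed

section \<open>Local orthonormal frames\<close>

text \<open>The map \<open>w \<mapsto> (\<langle>w, a\<rangle>, \<langle>w, b\<rangle>, 0)\<close> of \<open>\<real>\<^sup>3\<close> is not surjective, hence not injective.\<close>

lemma exists_orthogonal_vector:
  assumes p: "p \<in> topspace M" and a: "a \<in> T p" and b: "b \<in> T p"
    and ch: "(D, \<phi>) \<in> A" "p \<in> D"
  obtains w where "coord_vec D \<phi> w p \<noteq> tv_zero"
    "g p (coord_vec D \<phi> w p) a = 0" "g p (coord_vec D \<phi> w p) b = 0"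
proof -
  let ?e = "\<lambda>w. coord_vec D \<phi> w p"
  have eT: "?e w \<in> T p" for w using tangent_space_eq_range_coord_vec[OF ch] by blast
  define L where "L = (\<lambda>w. vector [g p (?e w) a, g p (?e w) b, 0] :: real^3)"
  have lin: "linear L"
    by (rule linearI) (simp_all add: L_def vec_eq_iff forall_3 coord_vec_add[OF ch] coord_vec_scale[OF ch]
        g_simps p eT a b)
  have "\<not> surj L"
  proof
    assume "surj L"
    then obtain w where "vector [0, 0, 1] = L w" by (meson surjD)
    then have "(vector [0, 0, 1] :: real^3) $ 3 = L w $ 3" by simp
    then show False by (simp add: L_def)
  qed
  then have "\<not> inj L" using linear_inj_imp_surj[OF lin] by blast
  then obtain w where w: "L w = 0" "w \<noteq> 0" using linear_injective_0[OF lin] by blast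
  have "L w $ 1 = 0" "L w $ 2 = 0" using w(1) by simp_all
  then have "g p (?e w) a = 0" "g p (?e w) b = 0" by (simp_all add: L_def)
  moreover have "?e w \<noteq> tv_zero" using coord_vec_eq_zeroD[OF ch] w(2) by blast
  ultimately show thesis by (rule that[rotated])
qed

text \<open>One Gram-Schmidt step: extend an orthogonal vector at \<open>p\<close> with constant coefficients, subtract
the projections, which vanish at \<open>p\<close>, and normalise where the result is nonzero. Allowing
\<open>b = 0\<close> lets the same lemma find both further members of a frame starting from one unit field.\<close>

lemma exists_orthogonal_unit_field:
  assumes W: "openin M W" "p \<in> W" and a: "vfield W a" "\<And>r. r \<in> W \<Longrightarrow> g r (a r) (a r) = 1"
    and b: "vfield W b" "\<And>r. r \<in> W \<Longrightarrow> g r (b r) (b r) = 1 \<or> b r = tv_zero"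
    and ab: "\<And>r. r \<in> W \<Longrightarrow> g r (a r) (b r) = 0"
  obtains V z where "openin M V" "p \<in> V" "V \<subseteq> W" "vfield V z"
    "\<And>r. r \<in> V \<Longrightarrow> g r (z r) (z r) = 1 \<and> g r (a r) (z r) = 0 \<and> g r (b r) (z r) = 0"
proof -
  have top: "r \<in> topspace M" if "r \<in> W" for r using W(1) openin_subset that by blast
  obtain D \<phi> where ch: "(D, \<phi>) \<in> A" "p \<in> D" using chart_at[OF top[OF W(2)]] .
  obtain w where w: "coord_vec D \<phi> w p \<noteq> tv_zero"
    "g p (coord_vec D \<phi> w p) (a p) = 0" "g p (coord_vec D \<phi> w p) (b p) = 0"
    using exists_orthogonal_vector[OF top[OF W(2)] vfield_tangent[OF a(1) W(2)] vfield_tangent[OF b(1) W(2)] ch] .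
  define e where "e = coord_vec D \<phi> w"
  define N where "N = D \<inter> W"
  have N: "openin M N" "p \<in> N" "N \<subseteq> W" using ch W chart_openin[OF ch(1)] unfolding N_def by auto
  have e: "vfield N e"
    using smooth_vfield_coord_vec[OF ch(1)] unfolding e_def N_def by (rule smooth_vfield_subset) auto
  have aN: "vfield N a" and bN: "vfield N b"
    using a(1) b(1) N(3) smooth_vfield_subset by blast+
  define y where "y = (\<lambda>r. e r -\<^sub>T g r (e r) (a r) *\<^sub>T a r -\<^sub>T g r (e r) (b r) *\<^sub>T b r)"
  have y: "vfield N y" unfolding y_def
    by (intro smooth_vfield_diff smooth_vfield_scale g_smooth N(1) e aN bN)
  note mem = vfield_tangent[OF e] vfield_tangent[OF aN] vfield_tangent[OF bN] vfield_tangent[OF y]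
  have ya: "g r (a r) (y r) = 0" if r: "r \<in> N" for r
  proof -
    have "r \<in> W" using r N(3) by blast
    then show ?thesis
      by (simp add: y_def g_simps top mem r a(2) ab g_sym[of r "a r" "e r"])
  qed
  have yb: "g r (b r) (y r) = 0" if r: "r \<in> N" for r
  proof -
    have rW: "r \<in> W" using r N(3) by blast
    have ba: "g r (b r) (a r) = 0" using ab[OF rW] g_sym[OF top[OF rW]] mem r by metis
    show ?thesis
      using b(2)[OF rW]
    proof
      assume "g r (b r) (b r) = 1"
      then show ?thesis
        by (simp add: y_def g_simps top[OF rW] mem r ba g_sym[of r "b r" "e r"])
    next
      assume "b r = tv_zero" then show ?thesis using g_zero_left[OF top[OF rW]] mem(4)[OF r] by simp
    qed
  qed
  have yp: "y p = e p"
    using w(2,3) unfolding y_def e_def by (simp add: tv_scale_def tv_diff_def)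
  define n where "n = (\<lambda>r. g r (y r) (y r))"
  have n: "smooth_fun A N n" unfolding n_def by (rule g_smooth[OF N(1) y y])
  define V where "V = {r \<in> N. n r \<in> {0<..}}"
  have V: "openin M V" "V \<subseteq> N"
    unfolding V_def by (auto intro: smooth_fun_preimage_openin[OF N(1) n] simp del: greaterThan_iff)
  have "n p > 0"
    unfolding n_def yp using g_pos[OF top[OF W(2)] mem(1)[OF N(2)]] w(1) by (simp add: e_def)
  then have pV: "p \<in> V" using N(2) by (simp add: V_def)
  \<comment> \<open>As \<open>n\<close> is the squared length, the power \<open>-1/2\<close> normalises \<open>y\<close>.\<close>
  define z where "z = (\<lambda>r. n r powr (-1/2) *\<^sub>T y r)"
  have yV: "vfield V y" using y V(2) smooth_vfield_subset by blast
  have z: "vfield V z" unfolding z_def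
    by (intro smooth_vfield_scale V(1) yV smooth_fun_powr smooth_fun_subset[OF n V(2)]) (simp add: V_def)
  show thesis
  proof (rule that[OF V(1) pV _ z])
    show "V \<subseteq> W" using V(2) N(3) by blast
    fix r assume r: "r \<in> V"
    then have rN: "r \<in> N" and nr: "n r > 0" unfolding V_def by auto
    have rt: "r \<in> topspace M" using rN N(3) top by blast
    have gn: "g r (y r) (y r) = n r" by (simp add: n_def)
    have "n r powr (-1/2) * n r powr (-1/2) = n r powr (-1/2 + -1/2)" by (rule powr_add[symmetric])
    also have "\<dots> = 1 / n r" using nr by (simp add: powr_neg_one)
    finally have "n r powr (-1/2) * (n r powr (-1/2) * n r) = 1"
      using nr by (simp add: mult.assoc[symmetric])
    then show "g r (z r) (z r) = 1 \<and> g r (a r) (z r) = 0 \<and> g r (b r) (z r) = 0"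
      using ya[OF rN] yb[OF rN] by (simp add: z_def g_simps rt mem rN gn)
  qed
qed

definition frame_on :: "'a set \<Rightarrow> 'a vfield \<Rightarrow> 'a vfield \<Rightarrow> 'a vfield \<Rightarrow> bool" where
  "frame_on W a b c \<longleftrightarrow> openin M W \<and> vfield W a \<and> vfield W b \<and> vfield W c \<and>
     (\<forall>r\<in>W. orthonormal3 r (a r) (b r) (c r))"

lemma local_orthonormal_frame_iff:
  "local_orthonormal_frame M A g q a b c \<longleftrightarrow> (\<exists>W. q \<in> W \<and> frame_on W a b c)"
proof
  assume "local_orthonormal_frame M A g q a b c"
  then obtain W where "openin M W" "q \<in> W" "vfield W a" "vfield W b" "vfield W c"
    "\<forall>r\<in>W. g r (a r) (a r) = 1 \<and> g r (b r) (b r) = 1 \<and> g r (c r) (c r) = 1 \<and>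
               g r (a r) (b r) = 0 \<and> g r (a r) (c r) = 0 \<and> g r (b r) (c r) = 0"
    unfolding local_orthonormal_frame_def by blast
  then show "\<exists>W. q \<in> W \<and> frame_on W a b c"
    unfolding frame_on_def orthonormal3_def
    by (intro exI[of _ W]) (auto intro: vfield_tangent dest: openin_subset)
next
  assume "\<exists>W. q \<in> W \<and> frame_on W a b c"
  then show "local_orthonormal_frame M A g q a b c"
    unfolding local_orthonormal_frame_def frame_on_def orthonormal3_def by blast
qed

lemma frame_on_subset: "frame_on W a b c \<Longrightarrow> openin M V \<Longrightarrow> V \<subseteq> W \<Longrightarrow> frame_on V a b c"
  unfolding frame_on_def using smooth_vfield_subset by blast

lemma exists_frame_on:
  assumes U: "openin M U" "p \<in> U" and k: "vfield U k" "\<And>q. q \<in> U \<Longrightarrow> g q (k q) (k q) = 1"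
  obtains W x y where "p \<in> W" "W \<subseteq> U" "frame_on W k x y"
proof -
  have top: "r \<in> topspace M" if "r \<in> U" for r using U(1) openin_subset that by blast
  \<comment> \<open>The zero field stands in for the second field, which does not exist yet.\<close>
  obtain V x where V: "openin M V" "p \<in> V" "V \<subseteq> U" "vfield V x"
    and x: "\<And>r. r \<in> V \<Longrightarrow> g r (x r) (x r) = 1 \<and> g r (k r) (x r) = 0 \<and> g r tv_zero (x r) = 0"
  proof (rule exists_orthogonal_unit_field[OF U k, of "\<lambda>r. tv_zero"])
    show "vfield U (\<lambda>r. tv_zero)" by (rule smooth_vfield_zero[OF U(1)])
    show "g r (k r) tv_zero = 0" if "r \<in> U" for r
      using g_zero_right[OF top[OF that] vfield_tangent[OF k(1) that]] .
  qed auto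
  have kV: "vfield V k" using k(1) V(3) smooth_vfield_subset by blast
  obtain W y where W: "openin M W" "p \<in> W" "W \<subseteq> V" "vfield W y"
    and y: "\<And>r. r \<in> W \<Longrightarrow> g r (y r) (y r) = 1 \<and> g r (k r) (y r) = 0 \<and> g r (x r) (y r) = 0"
    by (rule exists_orthogonal_unit_field[OF V(1,2) kV _ V(4)]) (use x k(2) V(3) in auto)
  have "frame_on W k x y"
    unfolding frame_on_def orthonormal3_def
  proof (intro conjI ballI)
    show kW: "vfield W k" and xW: "vfield W x" using kV V(4) W(3) smooth_vfield_subset by blast+
    fix r assume r: "r \<in> W"
    show "k r \<in> T r" "x r \<in> T r" "y r \<in> T r"
      using vfield_tangent[OF kW r] vfield_tangent[OF xW r] vfield_tangent[OF W(4) r] by auto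
    show "r \<in> topspace M" using r W(3) V(3) top by blast
    show "g r (k r) (k r) = 1" using r W(3) V(3) k(2) by blast
    show "g r (x r) (x r) = 1" "g r (k r) (x r) = 0" using r W(3) x by blast+
    show "g r (y r) (y r) = 1" "g r (k r) (y r) = 0" "g r (x r) (y r) = 0" using r y by blast+
  qed (use W in auto)
  then show thesis using that[of W x y] W V(3) by blast
qed

end

section \<open>The Levi-Civita connection and the Jacobi identity\<close>

locale levi_civita3 = riemannian3 +
  fixes nab :: "'a connection"
  assumes levi_civita: "levi_civita M A g nab"
begin

lemma affine: "affine_connection M A nab"
  using levi_civita unfolding levi_civita_def by blast

lemma affine_connectionD:
  assumes "openin M W" "vfield W Y" "vfield W Z" "p \<in> W" "v \<in> T p"
  shows "nab p v Y \<in> T p"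
    and "u \<in> T p \<Longrightarrow> nab p (a *\<^sub>T u +\<^sub>T b *\<^sub>T v) Y = a *\<^sub>T nab p u Y +\<^sub>T b *\<^sub>T nab p v Y"
    and "nab p v (\<lambda>q. Y q +\<^sub>T Z q) = nab p v Y +\<^sub>T nab p v Z"
    and "smooth_fun A W f \<Longrightarrow> nab p v (\<lambda>q. f q *\<^sub>T Y q) = v f *\<^sub>T Y p +\<^sub>T f p *\<^sub>T nab p v Y"
    and "(\<And>q. q \<in> W \<Longrightarrow> Y q = Z q) \<Longrightarrow> nab p v Y = nab p v Z"
  using affine[unfolded affine_connection_def, rule_format, THEN conjunct1, rule_format, OF conjI[OF assms(1) conjI[OF assms(2,3)]] assms(4,5)]
  by blast+

lemma nab_vfield: "openin M W \<Longrightarrow> vfield W Y \<Longrightarrow> vfield W Z \<Longrightarrow> vfield W (\<lambda>p. nab p (Z p) Y)"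
  using affine unfolding affine_connection_def by blast

lemma nab_tangent: "openin M W \<Longrightarrow> vfield W Y \<Longrightarrow> p \<in> W \<Longrightarrow> v \<in> T p \<Longrightarrow> nab p v Y \<in> T p"
  by (rule affine_connectionD(1))

lemma nab_tv_linear: 
  assumes "openin M W" "vfield W Y" "p \<in> W"
  shows "tv_linear p (\<lambda>v. nab p v Y)"
  unfolding tv_linear_def using affine_connectionD(1,2)[OF assms(1,2,2,3)] by blast

text \<open>On \<open>W\<close> the field agrees with its own multiple by the function 0, to which locality and the
Leibniz rule apply.\<close>

lemma nab_zero_field:
  assumes W: "openin M W" "p \<in> W" and v: "v \<in> T p" and z: "\<And>q. q \<in> W \<Longrightarrow> Y q = tv_zero"
  shows "nab p v Y = tv_zero"
proof -
  have p: "p \<in> topspace M" using W openin_subset by blast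
  have 0: "vfield W (\<lambda>q. tv_zero)" by (rule smooth_vfield_zero[OF W(1)])
  have Y: "vfield W Y" by (rule smooth_vfield_cong[OF W(1) _ 0]) (simp add: z)
  have "nab p v Y = nab p v (\<lambda>q. 0 *\<^sub>T Y q)"
    by (rule affine_connectionD(5)[OF W(1) Y _ W(2) v])
       (use 0 z in \<open>auto simp: tv_scale_zero\<close>)
  also have "\<dots> = v (\<lambda>q. 0) *\<^sub>T Y p +\<^sub>T 0 *\<^sub>T nab p v Y"
    by (rule affine_connectionD(4)[OF W(1) Y Y W(2) v smooth_fun_const[OF W(1)]])
  also have "\<dots> = tv_zero"
    by (simp add: tangent_const[OF p v] tv_scale_zero tv_add_zero)
  finally show ?thesis .
qed

lemma torsion_free:
  "openin M W \<Longrightarrow> vfield W X \<Longrightarrow> vfield W Y \<Longrightarrow> p \<in> W \<Longrightarrow>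
   lie_bracket M A X Y p = nab p (X p) Y -\<^sub>T nab p (Y p) X"
  and metric_compatible:
  "openin M W \<Longrightarrow> vfield W X \<Longrightarrow> vfield W Y \<Longrightarrow> p \<in> W \<Longrightarrow> v \<in> T p \<Longrightarrow>
   v (\<lambda>q. g q (X q) (Y q)) = g p (nab p v X) (Y p) + g p (X p) (nab p v Y)"
  using levi_civita unfolding levi_civita_def by metis+

text \<open>Used with constant inner products of unit or orthogonal fields, this moves a covariant
derivative from one factor to the other.\<close>

lemma metric_compatible_const:
  assumes W: "openin M W" "vfield W X" "vfield W Y" "p \<in> W" "v \<in> T p"
    and c: "\<And>q. q \<in> W \<Longrightarrow> g q (X q) (Y q) = c"
  shows "g p (X p) (nab p v Y) = - g p (nab p v X) (Y p)"
proof -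
  have p: "p \<in> topspace M" using W openin_subset by blast
  have "v (\<lambda>q. g q (X q) (Y q)) = v (\<lambda>q. c)" by (rule tangent_cong[OF W(1,4,5) c])
  then show ?thesis
    using metric_compatible[OF W] tangent_const[OF p W(5)] by simp
qed

lemma lie_bracket_vfield:
  assumes "openin M W" "vfield W X" "vfield W Y"
  shows "vfield W (lie_bracket M A X Y)"
  by (rule smooth_vfield_cong[OF assms(1) torsion_free[OF assms, symmetric]])
     (auto intro!: smooth_vfield_diff nab_vfield assms)

lemma lie_bracket_nested:
  assumes W: "openin M W" and X: "vfield W X" and Y: "vfield W Y" and Z: "vfield W Z"
    and q: "q \<in> W" and f: "smooth_near M A q f"
  shows "lie_bracket M A X (lie_bracket M A Y Z) q f =
    X q (\<lambda>r. Y r (\<lambda>s. Z s f)) - X q (\<lambda>r. Z r (\<lambda>s. Y s f)) -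
    (Y q (\<lambda>r. Z r (\<lambda>s. X s f)) - Z q (\<lambda>r. Y r (\<lambda>s. X s f)))"
proof -
  have top: "q \<in> topspace M" using W q openin_subset by blast
  obtain V where V: "openin M V" "q \<in> V" "smooth_fun A V f"
    using f unfolding smooth_near_def by blast
  have near: "smooth_near M A r f" if "r \<in> V" for r
    using V(1) that V(3) by (rule smooth_nearI)
  have "X q (\<lambda>r. lie_bracket M A Y Z r f) = X q (\<lambda>r. Y r (\<lambda>s. Z s f) - Z r (\<lambda>s. Y s f))"
    by (rule tangent_cong[OF V(1,2) vfield_tangent[OF X q]]) (simp add: lie_bracket_def near)
  also have "\<dots> = X q (\<lambda>r. Y r (\<lambda>s. Z s f)) - X q (\<lambda>r. Z r (\<lambda>s. Y s f))"
    by (rule tangent_diff_fun[OF top vfield_tangent[OF X q]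
        vfield_smooth_near[OF Y W q vfield_smooth_near[OF Z W q f]]
        vfield_smooth_near[OF Z W q vfield_smooth_near[OF Y W q f]]])
  finally have 1: "X q (\<lambda>r. lie_bracket M A Y Z r f) = \<dots>" .
  have 2: "smooth_near M A q (\<lambda>s. X s f)" by (rule vfield_smooth_near[OF X W q f])
  show ?thesis
    using 1 2 f by (simp add: lie_bracket_def)
qed

text \<open>As operators on functions that are smooth near \<open>q\<close> both sides expand to the same six triple
products; on all other functions both are 0 by convention.\<close>

lemma jacobi_identity:
  assumes W: "openin M W" and X: "vfield W X" and Y: "vfield W Y" and Z: "vfield W Z" and q: "q \<in> W"
  shows "lie_bracket M A X (lie_bracket M A Y Z) q =
    lie_bracket M A Y (lie_bracket M A X Z) q -\<^sub>T lie_bracket M A Z (lie_bracket M A X Y) q"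
proof
  fix f
  show "lie_bracket M A X (lie_bracket M A Y Z) q f =
    (lie_bracket M A Y (lie_bracket M A X Z) q -\<^sub>T lie_bracket M A Z (lie_bracket M A X Y) q) f"
  proof (cases "smooth_near M A q f")
    case True
    show ?thesis
      unfolding tv_diff_def lie_bracket_nested[OF W X Y Z q True] lie_bracket_nested[OF W Y X Z q True]
        lie_bracket_nested[OF W Z X Y q True] by simp
  qed (simp add: tv_diff_def lie_bracket_def)
qed

end

section \<open>Geodesic unit fields: twist and divergence\<close>

locale geodesic_unit_field = levi_civita3 +
  fixes U :: "'a set" and k :: "'a vfield"
  assumes U: "openin M U" and k: "smooth_vfield M A U k"
    and unit: "q \<in> U \<Longrightarrow> g q (k q) (k q) = 1"
    and geodesic: "q \<in> U \<Longrightarrow> nab q (k q) k = tv_zero"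
begin

lemma U_top: "q \<in> U \<Longrightarrow> q \<in> topspace M"
  using U openin_subset by blast

lemma k_tangent: "q \<in> U \<Longrightarrow> k q \<in> T q"
  using k vfield_tangent by blast

lemma nab_k_tangent: "q \<in> U \<Longrightarrow> v \<in> T q \<Longrightarrow> nab q v k \<in> T q"
  by (rule nab_tangent[OF U k])

lemma nab_k_tv_linear: "q \<in> U \<Longrightarrow> tv_linear q (\<lambda>v. nab q v k)"
  by (rule nab_tv_linear[OF U k])

lemma nab_k_orth: 
  assumes "q \<in> U" "v \<in> T q" shows "g q (nab q v k) (k q) = 0" "g q (k q) (nab q v k) = 0"
  using metric_compatible_const[OF U k k assms unit]
    g_sym[OF U_top k_tangent nab_k_tangent, OF assms(1,1) assms] by simp_all

text \<open>This is \<open>- d\<theta>(u, v)\<close> for \<open>\<theta> = \<langle>k, _\<rangle>\<close>. Unlike \<open>rotation\<close> it is a form on tangent vectors, so it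
can be evaluated without a frame.\<close>

definition twist :: "'a \<Rightarrow> 'a tvec \<Rightarrow> 'a tvec \<Rightarrow> real" where
  "twist q u v = g q (nab q v k) u - g q (nab q u k) v"

lemma rotation_eq_twist: "rotation g nab k x y q = twist q (x q) (y q)"
  by (simp add: rotation_def twist_def)

text \<open>Since \<open>\<nabla>\<^sub>k k = 0\<close> and \<open>\<nabla>\<^sub>v k\<close> is orthogonal to \<open>k\<close>, only the \<open>2 \<times> 2\<close> block on \<open>k\<^sup>\<bottom>\<close> of
\<open>v \<mapsto> \<nabla>\<^sub>v k\<close> contributes.\<close>

lemma nab_k_inner:
  assumes q: "q \<in> U" and o: "orthonormal3 q (k q) e f" and u: "u \<in> T q" and v: "v \<in> T q"
  shows "g q (nab q u k) v =
    g q u e * (g q (nab q e k) e * g q v e + g q (nab q e k) f * g q v f) +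
    g q u f * (g q (nab q f k) e * g q v e + g q (nab q f k) f * g q v f)"
proof -
  note o' = orthonormal3D[OF o]
  have e: "nab q u k = g q u (k q) *\<^sub>T nab q (k q) k +\<^sub>T g q u e *\<^sub>T nab q e k +\<^sub>T g q u f *\<^sub>T nab q f k"
    by (rule tv_linear_expand[OF nab_k_tv_linear[OF q] o u])
  have w: "g q (nab q w k) v = g q (nab q w k) e * g q v e + g q (nab q w k) f * g q v f" if "w \<in> T q" for w
    using orthonormal3_inner[OF o nab_k_tangent[OF q that] v] nab_k_orth[OF q that] by simp
  have "g q (nab q u k) v = g q u e * g q (nab q e k) v + g q u f * g q (nab q f k) v"
    by (subst e) (simp add: geodesic[OF q] g_simps o' nab_k_tangent q v)
  then show ?thesis using w[OF o'(3)] w[OF o'(4)] by simp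
qed

text \<open>The form \<open>twist\<close> has \<open>k\<close> in its kernel and is therefore a multiple of the area form of \<open>k\<^sup>\<bottom>\<close>.\<close>

lemma twist_expand:
  assumes q: "q \<in> U" and o: "orthonormal3 q (k q) e f" and u: "u \<in> T q" and v: "v \<in> T q"
  shows "twist q u v = (g q u e * g q v f - g q u f * g q v e) * twist q e f"
  unfolding twist_def nab_k_inner[OF q o u v] nab_k_inner[OF q o v u] by (simp add: algebra_simps)

lemma frame_iff:
  assumes "q \<in> U"
  shows "local_orthonormal_frame M A g q k x y \<longleftrightarrow> (\<exists>W. q \<in> W \<and> W \<subseteq> U \<and> frame_on W k x y)"
  unfolding local_orthonormal_frame_iff
proof
  assume "\<exists>W. q \<in> W \<and> frame_on W k x y"
  then obtain W where W: "q \<in> W" "frame_on W k x y" by blast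
  have "frame_on (W \<inter> U) k x y"
    by (rule frame_on_subset[OF W(2)]) (use W(2) U in \<open>auto simp: frame_on_def\<close>)
  with W(1) assms show "\<exists>W. q \<in> W \<and> W \<subseteq> U \<and> frame_on W k x y"
    by (intro exI[of _ "W \<inter> U"]) simp
qed auto

lemma frame_orthonormal3: "frame_on W k x y \<Longrightarrow> q \<in> W \<Longrightarrow> orthonormal3 q (k q) (x q) (y q)"
  unfolding frame_on_def by blast

text \<open>Two orthonormal completions of \<open>k q\<close> change \<open>twist e f\<close> by a determinant factor, so its
vanishing may be tested on any of them.\<close>

lemma hypersurface_orthogonal_iff:
  assumes q: "q \<in> U" and o: "orthonormal3 q (k q) e f"
  shows "hypersurface_orthogonal M A g nab k q \<longleftrightarrow> twist q e f = 0"
proof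
  note o' = orthonormal3D[OF o]
  assume "hypersurface_orthogonal M A g nab k q"
  then obtain x y where "local_orthonormal_frame M A g q k x y" "twist q (x q) (y q) = 0"
    unfolding hypersurface_orthogonal_def rotation_eq_twist by blast
  then obtain W where W: "q \<in> W" "W \<subseteq> U" "frame_on W k x y" "twist q (x q) (y q) = 0"
    unfolding frame_iff[OF q] by blast
  show "twist q e f = 0"
    using twist_expand[OF q frame_orthonormal3[OF W(3,1)] o'(3,4)] W(4) by simp
next
  assume z: "twist q e f = 0"
  obtain W x y where W: "q \<in> W" "W \<subseteq> U" "frame_on W k x y"
    using exists_frame_on[OF U q k unit] by blast
  note w' = orthonormal3D[OF frame_orthonormal3[OF W(3,1)]]
  have "twist q (x q) (y q) = 0"
    using twist_expand[OF q o w'(3,4)] z by simp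
  then show "hypersurface_orthogonal M A g nab k q"
    unfolding hypersurface_orthogonal_def rotation_eq_twist frame_iff[OF q] using W by blast
qed

lemma divergence_eq:
  assumes q: "q \<in> U" and o: "orthonormal3 q (k q) e f"
  shows "divergence M A g nab k q = g q (nab q e k) e + g q (nab q f k) f"
proof -
  let ?P = "\<lambda>(x, y). local_orthonormal_frame M A g q k x y"
  obtain x y where xy: "(SOME p. ?P p) = (x, y)" by fastforce
  have "\<exists>p. ?P p" 
    using exists_frame_on[OF U q k unit] frame_iff[OF q] by (metis (no_types, lifting) case_prodI)
  then have "?P (SOME p. ?P p)" by (rule someI_ex)
  then obtain W where W: "q \<in> W" "W \<subseteq> U" "frame_on W k x y"
    unfolding xy using frame_iff[OF q] by auto
  note o2 = frame_orthonormal3[OF W(3,1)]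
  have "g q (nab q (k q) k) (k q) + g q (nab q (x q) k) (x q) + g q (nab q (y q) k) (y q) =
    g q (nab q (k q) k) (k q) + g q (nab q e k) e + g q (nab q f k) f"
    by (rule trace_orthonormal3[OF nab_k_tv_linear[OF q] o o2])
  moreover have "divergence M A g nab k q = g q (nab q (x q) k) (x q) + g q (nab q (y q) k) (y q)"
    unfolding divergence_def using xy by simp
  ultimately show ?thesis by simp
qed

section \<open>Ricci curvature in the direction of the field\<close>

text \<open>For \<open>k\<close> geodesic the first term of \<open>R(X, k) k\<close> is \<open>\<nabla>\<^sub>X (\<nabla>\<^sub>k k) = 0\<close>. The trace of this operator
is \<open>Ric(k, k)\<close>.\<close>

definition radial_curv :: "'a vfield \<Rightarrow> 'a vfield" where
  "radial_curv X = curvature M A nab X k k"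

text \<open>Writing the bracket through the torsion-free connection leaves only covariant derivatives, whose
behaviour under sums and multiples of fields is known.\<close>

lemma radial_curv_eq:
  assumes W: "openin M W" "W \<subseteq> U" and X: "vfield W X" and q: "q \<in> W"
  shows "radial_curv X q = tv_zero -\<^sub>T nab q (k q) (\<lambda>r. nab r (X r) k) -\<^sub>T
    nab q (nab q (X q) k -\<^sub>T nab q (k q) X) k"
proof -
  have kW: "vfield W k" using k W(2) smooth_vfield_subset by blast
  have "nab q (X q) (\<lambda>r. nab r (k r) k) = tv_zero"
    by (rule nab_zero_field[OF W(1) q vfield_tangent[OF X q]]) (use geodesic W(2) in blast)
  then show ?thesis
    unfolding radial_curv_def curvature_def torsion_free[OF W(1) X kW q] by simp
qed

lemma radial_curv_tangent:
  assumes W: "openin M W" "W \<subseteq> U" and X: "vfield W X" and q: "q \<in> W"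
  shows "radial_curv X q \<in> T q"
proof -
  have kW: "vfield W k" using k W(2) smooth_vfield_subset by blast
  have top: "q \<in> topspace M" using U_top W(2) q by blast
  note nt = nab_tangent[OF W(1) _ q] and kq = vfield_tangent[OF kW q] and Xq = vfield_tangent[OF X q]
  show ?thesis
    unfolding radial_curv_eq[OF assms]
    by (intro tangent_diff tangent_zero top nt kW X nab_vfield W(1) kq Xq)
qed

lemma radial_curv_cong:
  assumes W: "openin M W" "W \<subseteq> U" and X: "vfield W X" and q: "q \<in> W"
    and eq: "\<And>r. r \<in> W \<Longrightarrow> X r = Y r"
  shows "radial_curv X q = radial_curv Y q"
proof -
  have kW: "vfield W k" using k W(2) smooth_vfield_subset by blast
  have Y: "vfield W Y" using smooth_vfield_cong[OF W(1) eq X] .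
  note kq = vfield_tangent[OF kW q]
  have "nab q (k q) (\<lambda>r. nab r (X r) k) = nab q (k q) (\<lambda>r. nab r (Y r) k)"
    by (rule affine_connectionD(5)[OF W(1) nab_vfield[OF W(1) kW X] nab_vfield[OF W(1) kW Y] q kq])
       (simp add: eq)
  moreover have "nab q (k q) X = nab q (k q) Y"
    by (rule affine_connectionD(5)[OF W(1) X Y q kq eq])
  ultimately show ?thesis
    unfolding radial_curv_eq[OF W X q] radial_curv_eq[OF W Y q] eq[OF q] by simp
qed

lemma radial_curv_add:
  assumes W: "openin M W" "W \<subseteq> U" and X: "vfield W X" and Y: "vfield W Y" and q: "q \<in> W"
  shows "radial_curv (\<lambda>r. X r +\<^sub>T Y r) q = radial_curv X q +\<^sub>T radial_curv Y q"
proof -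
  have kW: "vfield W k" using k W(2) smooth_vfield_subset by blast
  have top: "q \<in> topspace M" using U_top W(2) q by blast
  note nt = nab_tangent[OF W(1) _ q] and nv = nab_vfield[OF W(1) kW]
  note kq = vfield_tangent[OF kW q] and Xq = vfield_tangent[OF X q] and Yq = vfield_tangent[OF Y q]
  have lin: "nab r (a *\<^sub>T u +\<^sub>T b *\<^sub>T v) k = a *\<^sub>T nab r u k +\<^sub>T b *\<^sub>T nab r v k"
    if "r \<in> W" "u \<in> T r" "v \<in> T r" for a b r u v
    by (rule affine_connectionD(2)[OF W(1) kW kW that(1,3,2)])
  have add: "nab r (X r +\<^sub>T Y r) k = nab r (X r) k +\<^sub>T nab r (Y r) k" if "r \<in> W" for r
    using lin[OF that vfield_tangent[OF X that] vfield_tangent[OF Y that], of 1 1] by (simp add: tv_scale_one)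
  have 1: "nab q (k q) (\<lambda>r. nab r (X r +\<^sub>T Y r) k) =
      nab q (k q) (\<lambda>r. nab r (X r) k) +\<^sub>T nab q (k q) (\<lambda>r. nab r (Y r) k)"
  proof -
    have "nab q (k q) (\<lambda>r. nab r (X r +\<^sub>T Y r) k) = nab q (k q) (\<lambda>r. nab r (X r) k +\<^sub>T nab r (Y r) k)"
      by (rule affine_connectionD(5)[OF W(1) _ _ q kq add])
         (intro nv smooth_vfield_add W(1) X Y)+
    also have "\<dots> = nab q (k q) (\<lambda>r. nab r (X r) k) +\<^sub>T nab q (k q) (\<lambda>r. nab r (Y r) k)"
      by (rule affine_connectionD(3)[OF W(1) nv[OF X] nv[OF Y] q kq])
    finally show ?thesis .
  qed
  have 2: "nab q (k q) (\<lambda>r. X r +\<^sub>T Y r) = nab q (k q) X +\<^sub>T nab q (k q) Y"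
    by (rule affine_connectionD(3)[OF W(1) X Y q kq])
  define u where "u = nab q (X q) k -\<^sub>T nab q (k q) X"
  define v where "v = nab q (Y q) k -\<^sub>T nab q (k q) Y"
  have uv: "u \<in> T q" "v \<in> T q"
    unfolding u_def v_def by (intro tangent_diff top nt kW X Y kq Xq Yq)+
  have 3: "nab q (X q +\<^sub>T Y q) k -\<^sub>T (nab q (k q) X +\<^sub>T nab q (k q) Y) = 1 *\<^sub>T u +\<^sub>T 1 *\<^sub>T v"
    unfolding add[OF q] by (simp add: u_def v_def tv_add_def tv_diff_def tv_scale_def fun_eq_iff)
  show ?thesis
    unfolding radial_curv_eq[OF W smooth_vfield_add[OF W(1) X Y] q] radial_curv_eq[OF W X q] radial_curv_eq[OF W Y q] 1 2 3 lin[OF q uv]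
    unfolding u_def v_def
    by (simp add: tv_add_def tv_diff_def tv_scale_def tv_zero_def fun_eq_iff)
qed

text \<open>The two terms with the derivative \<open>k f\<close>, one from the Leibniz rule for \<open>\<nabla>\<^sub>k (\<nabla>\<^sub>X k)\<close> and one
from that for \<open>\<nabla>\<^sub>k X\<close> inside the bracket, cancel.\<close>

lemma radial_curv_scale:
  assumes W: "openin M W" "W \<subseteq> U" and X: "vfield W X" and f: "smooth_fun A W f" and q: "q \<in> W"
  shows "radial_curv (\<lambda>r. f r *\<^sub>T X r) q = f q *\<^sub>T radial_curv X q"
proof -
  have kW: "vfield W k" using k W(2) smooth_vfield_subset by blast
  have top: "q \<in> topspace M" using U_top W(2) q by blast
  note nt = nab_tangent[OF W(1) _ q] and nv = nab_vfield[OF W(1) kW]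
  note kq = vfield_tangent[OF kW q] and Xq = vfield_tangent[OF X q]
  have lin: "nab r (a *\<^sub>T u +\<^sub>T b *\<^sub>T v) k = a *\<^sub>T nab r u k +\<^sub>T b *\<^sub>T nab r v k"
    if "r \<in> W" "u \<in> T r" "v \<in> T r" for a b r u v
    by (rule affine_connectionD(2)[OF W(1) kW kW that(1,3,2)])
  have scale: "nab r (f r *\<^sub>T X r) k = f r *\<^sub>T nab r (X r) k" if "r \<in> W" for r
    using lin[OF that vfield_tangent[OF X that] vfield_tangent[OF X that], of "f r" 0]
    by (simp add: tv_scale_zero tv_add_zero)
  have 1: "nab q (k q) (\<lambda>r. nab r (f r *\<^sub>T X r) k) =
      k q f *\<^sub>T nab q (X q) k +\<^sub>T f q *\<^sub>T nab q (k q) (\<lambda>r. nab r (X r) k)"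
  proof -
    have "nab q (k q) (\<lambda>r. nab r (f r *\<^sub>T X r) k) = nab q (k q) (\<lambda>r. f r *\<^sub>T nab r (X r) k)"
      by (rule affine_connectionD(5)[OF W(1) _ _ q kq scale])
         (intro nv smooth_vfield_scale W(1) X f)+
    also have "\<dots> = k q f *\<^sub>T nab q (X q) k +\<^sub>T f q *\<^sub>T nab q (k q) (\<lambda>r. nab r (X r) k)"
      by (rule affine_connectionD(4)[OF W(1) nv[OF X] nv[OF X] q kq f])
    finally show ?thesis .
  qed
  have 2: "nab q (k q) (\<lambda>r. f r *\<^sub>T X r) = k q f *\<^sub>T X q +\<^sub>T f q *\<^sub>T nab q (k q) X"
    by (rule affine_connectionD(4)[OF W(1) X X q kq f])
  define u where "u = nab q (X q) k -\<^sub>T nab q (k q) X"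
  have u: "u \<in> T q"
    unfolding u_def by (intro tangent_diff top nt kW X kq Xq)+
  have 3: "nab q (f q *\<^sub>T X q) k -\<^sub>T (k q f *\<^sub>T X q +\<^sub>T f q *\<^sub>T nab q (k q) X) =
      f q *\<^sub>T u +\<^sub>T (- k q f) *\<^sub>T X q"
    unfolding scale[OF q] by (simp add: u_def tv_add_def tv_diff_def tv_scale_def fun_eq_iff algebra_simps)
  show ?thesis
    unfolding radial_curv_eq[OF W smooth_vfield_scale[OF W(1) X f] q] radial_curv_eq[OF W X q] 1 2 3 lin[OF q u Xq]
    unfolding u_def
    by (simp add: tv_add_def tv_diff_def tv_scale_def tv_zero_def fun_eq_iff algebra_simps)
qed

text \<open>Tensoriality: the value at \<open>q\<close> depends on \<open>X q\<close> only, by expanding \<open>X\<close> in a frame with smooth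
coefficients.\<close>

lemma radial_curv_expand:
  assumes W: "W \<subseteq> U" "frame_on W k x y" and X: "vfield W X" and q: "q \<in> W"
  shows "radial_curv X q = g q (X q) (k q) *\<^sub>T radial_curv k q +\<^sub>T g q (X q) (x q) *\<^sub>T radial_curv x q +\<^sub>T g q (X q) (y q) *\<^sub>T radial_curv y q"
proof -
  have o: "openin M W" and f: "vfield W k" "vfield W x" "vfield W y" using W(2) unfolding frame_on_def by auto
  let ?f = "\<lambda>e r. g r (X r) (e r)"
  have sm: "smooth_fun A W (?f k)" "smooth_fun A W (?f x)" "smooth_fun A W (?f y)"
    by (intro g_smooth[OF o X] f)+
  note sc = smooth_vfield_scale[OF o f(1) sm(1)] smooth_vfield_scale[OF o f(2) sm(2)]
    smooth_vfield_scale[OF o f(3) sm(3)]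
  have "radial_curv X q = radial_curv (\<lambda>r. ?f k r *\<^sub>T k r +\<^sub>T ?f x r *\<^sub>T x r +\<^sub>T ?f y r *\<^sub>T y r) q"
    by (rule radial_curv_cong[OF o W(1) X q])
       (rule orthonormal3_expand[OF frame_orthonormal3[OF W(2)]], auto intro: vfield_tangent[OF X])
  then show ?thesis
    using radial_curv_add[OF o W(1) smooth_vfield_add[OF o sc(1,2)] sc(3) q] radial_curv_add[OF o W(1) sc(1,2) q]
      radial_curv_scale[OF o W(1) f(1) sm(1) q] radial_curv_scale[OF o W(1) f(2) sm(2) q] radial_curv_scale[OF o W(1) f(3) sm(3) q]
    by simp
qed

lemma radial_curv_k: assumes q: "q \<in> U" shows "radial_curv k q = tv_zero"
proof -
  have z: "nab q (k q) (\<lambda>r. nab r (k r) k) = tv_zero"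
    by (rule nab_zero_field[OF U q k_tangent[OF q] geodesic])
  have "nab q (0 *\<^sub>T k q +\<^sub>T 0 *\<^sub>T k q) k = 0 *\<^sub>T nab q (k q) k +\<^sub>T 0 *\<^sub>T nab q (k q) k"
    by (rule affine_connectionD(2)[OF U k k q k_tangent[OF q] k_tangent[OF q]])
  then have "nab q tv_zero k = tv_zero" by (simp add: tv_scale_zero tv_add_zero)
  moreover have "tv_zero -\<^sub>T tv_zero = (tv_zero :: 'a tvec)" by (simp add: tv_diff_def tv_zero_def)
  ultimately show ?thesis
    unfolding radial_curv_eq[OF U subset_refl k q] z geodesic[OF q] by simp
qed

text \<open>By tensoriality \<open>X \<mapsto> R(X, k) k\<close> at \<open>q\<close> is an endomorphism \<open>L\<close> of the tangent space, whose trace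
in the chosen frame equals the one in \<open>k, x, y\<close>.\<close>

lemma ricci_eq:
  assumes W: "W \<subseteq> U" "frame_on W k x y" and q: "q \<in> W"
  shows "ricci M A g nab k k q = g q (radial_curv x q) (x q) + g q (radial_curv y q) (y q)"
proof -
  have o: "openin M W" and f: "vfield W k" "vfield W x" "vfield W y" using W(2) unfolding frame_on_def by auto
  have qU: "q \<in> U" using W q by blast
  note o1 = frame_orthonormal3[OF W(2) q]
  note o1' = orthonormal3D[OF o1]
  note KT = radial_curv_tangent[OF o W(1) _ q]
  let ?P = "\<lambda>(a, b, c). local_orthonormal_frame M A g q a b c"
  obtain a b c where abc: "(SOME p. ?P p) = (a, b, c)" by (metis prod_cases3)
  have "?P (k, x, y)" using W(2) q local_orthonormal_frame_iff by auto
  then have "?P (SOME p. ?P p)" by (rule someI)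
  then obtain W' where W': "q \<in> W'" "frame_on W' a b c"
    unfolding abc using local_orthonormal_frame_iff by auto
  \<comment> \<open>The frame chosen by \<open>ricci\<close> comes with its own neighbourhood.\<close>
  let ?V = "W \<inter> W'"
  have V: "openin M ?V" "?V \<subseteq> U" "q \<in> ?V" using o W' W(1) q unfolding frame_on_def by auto
  have F: "frame_on ?V k x y" "frame_on ?V a b c"
    using frame_on_subset[OF W(2) V(1)] frame_on_subset[OF W'(2) V(1)] by auto
  then have abcV: "vfield ?V a" "vfield ?V b" "vfield ?V c" unfolding frame_on_def by auto
  have o2: "orthonormal3 q (a q) (b q) (c q)" using F(2) V(3) unfolding frame_on_def by blast
  define L where "L u = g q u (k q) *\<^sub>T radial_curv k q +\<^sub>T g q u (x q) *\<^sub>T radial_curv x q +\<^sub>T g q u (y q) *\<^sub>T radial_curv y q" for u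
  have lin: "tv_linear q L"
    unfolding tv_linear_def
  proof (intro conjI ballI allI)
    show "L u \<in> T q" for u
      unfolding L_def by (intro tangent_add tangent_scale KT f o1')
    show "L (\<alpha> *\<^sub>T u +\<^sub>T \<beta> *\<^sub>T v) = \<alpha> *\<^sub>T L u +\<^sub>T \<beta> *\<^sub>T L v" if "u \<in> T q" "v \<in> T q" for u v \<alpha> \<beta>
      unfolding L_def
      by (simp add: g_simps that o1') (simp add: tv_add_def tv_scale_def fun_eq_iff algebra_simps)
  qed
  have KL: "radial_curv X q = L (X q)" if "vfield ?V X" for X
    unfolding L_def by (rule radial_curv_expand[OF V(2) F(1) that V(3)])
  have "ricci M A g nab k k q = g q (L (a q)) (a q) + g q (L (b q)) (b q) + g q (L (c q)) (c q)"
    using abc KL[OF abcV(1)] KL[OF abcV(2)] KL[OF abcV(3)] by (simp add: ricci_def radial_curv_def)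
  also have "\<dots> = g q (L (k q)) (k q) + g q (L (x q)) (x q) + g q (L (y q)) (y q)"
    by (rule trace_orthonormal3[OF lin o1 o2])
  also have "\<dots> = g q (radial_curv k q) (k q) + g q (radial_curv x q) (x q) + g q (radial_curv y q) (y q)"
    using KL[of k] KL[of x] KL[of y] F(1) unfolding frame_on_def by simp
  also have "g q (radial_curv k q) (k q) = 0"
    unfolding radial_curv_k[OF qU] by (rule g_zero_left[OF o1'(1,2)])
  finally show ?thesis by simp
qed

end

section \<open>Evolution of rotation and divergence\<close>

text \<open>A fixed frame \<open>k, x, y\<close> in which the quantities of the theorem are smooth functions and can be
differentiated in the direction \<open>k\<close>.\<close>

locale adapted_frame = geodesic_unit_field +
  fixes W :: "'a set" and x y :: "'a vfield"
  assumes WU: "W \<subseteq> U" and frame: "frame_on W k x y"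
begin

lemma W: "openin M W" and kW: "vfield W k" and xW: "vfield W x" and yW: "vfield W y"
  using frame unfolding frame_on_def by auto

lemma frame_orthonormal: "q \<in> W \<Longrightarrow> orthonormal3 q (k q) (x q) (y q)"
  using frame by (rule frame_orthonormal3)

text \<open>The functions \<open>a, b, c, d\<close> form the matrix of \<open>v \<mapsto> \<nabla>\<^sub>v k\<close> on \<open>k\<^sup>\<bottom>\<close>, and \<open>m\<close> is the speed at
which \<open>x, y\<close> rotate along \<open>k\<close>.\<close>

definition a where "a q = g q (nab q (x q) k) (x q)"
definition b where "b q = g q (nab q (x q) k) (y q)"
definition c where "c q = g q (nab q (y q) k) (x q)"
definition d where "d q = g q (nab q (y q) k) (y q)"
definition m where "m q = g q (nab q (k q) x) (y q)"

definition \<omega> where "\<omega> q = twist q (x q) (y q)"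

lemma \<omega>_eq: "\<omega> q = c q - b q"
  by (simp add: \<omega>_def twist_def b_def c_def)

lemma smooth_abcd: "smooth_fun A W a" "smooth_fun A W d" "smooth_fun A W \<omega>"
proof -
  show "smooth_fun A W a" "smooth_fun A W d"
    unfolding a_def d_def by (intro g_smooth W nab_vfield kW xW yW)+
  have "smooth_fun A W (\<lambda>q. c q - b q)"
    unfolding b_def c_def by (intro smooth_fun_diff g_smooth W nab_vfield kW xW yW)
  then show "smooth_fun A W \<omega>" unfolding \<omega>_eq .
qed

lemma nab_k_inner_frame:
  assumes q: "q \<in> W" and u: "u \<in> T q" and v: "v \<in> T q"
  shows "g q (nab q u k) v = g q u (x q) * (a q * g q v (x q) + b q * g q v (y q)) +
    g q u (y q) * (c q * g q v (x q) + d q * g q v (y q))"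
  unfolding a_def b_def c_def d_def
  using nab_k_inner[OF _ frame_orthonormal[OF q] u v] q WU by blast

text \<open>The frame rotates about \<open>k\<close> only: \<open>\<nabla>\<^sub>k x = m y\<close> and \<open>\<nabla>\<^sub>k y = - m x\<close>.\<close>

lemma frame_derivative:
  assumes q: "q \<in> W"
  shows "g q (nab q (k q) x) (k q) = 0" "g q (nab q (k q) y) (k q) = 0"
    "g q (nab q (k q) x) (x q) = 0" "g q (nab q (k q) y) (y q) = 0"
    "g q (nab q (k q) x) (y q) = m q" "g q (nab q (k q) y) (x q) = - m q"
proof -
  have qU: "q \<in> U" using q WU by blast
  note o = orthonormal3D[OF frame_orthonormal]
  note kq = o(2)[OF q]
  have nt: "nab q (k q) x \<in> T q" "nab q (k q) y \<in> T q"
    by (intro nab_tangent[OF W _ q kq] xW yW)+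
  have z: "g q tv_zero (x q) = 0" "g q tv_zero (y q) = 0" using g_zero_left o q by blast+
  have "g q (k q) (nab q (k q) x) = 0" "g q (k q) (nab q (k q) y) = 0"
    using metric_compatible_const[OF W kW xW q kq o(8)] metric_compatible_const[OF W kW yW q kq o(9)]
    by (simp_all add: geodesic[OF qU] z)
  then show "g q (nab q (k q) x) (k q) = 0" "g q (nab q (k q) y) (k q) = 0"
    using g_sym[OF o(1)[OF q]] nt kq by metis+
  show "g q (nab q (k q) x) (x q) = 0" "g q (nab q (k q) y) (y q) = 0"
    using metric_compatible_const[OF W xW xW q kq o(6)] metric_compatible_const[OF W yW yW q kq o(7)]
      g_sym[OF o(1)[OF q] nt(1) o(3)[OF q]] g_sym[OF o(1)[OF q] nt(2) o(4)[OF q]] by simp_all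
  show "g q (nab q (k q) x) (y q) = m q" by (simp add: m_def)
  show "g q (nab q (k q) y) (x q) = - m q"
    using metric_compatible_const[OF W xW yW q kq o(10)]
      g_sym[OF o(1)[OF q] nt(2) o(3)[OF q]] by (simp add: m_def)
qed

text \<open>For fields orthogonal to \<open>k\<close> the formula \<open>d\<theta>(X, Y) = X \<theta>(Y) - Y \<theta>(X) - \<theta>([X, Y])\<close> loses its
first two terms.\<close>

lemma bracket_inner:
  assumes q: "q \<in> W" and X: "vfield W X" "\<And>r. r \<in> W \<Longrightarrow> g r (k r) (X r) = 0"
    and Y: "vfield W Y" "\<And>r. r \<in> W \<Longrightarrow> g r (k r) (Y r) = 0"
  shows "g q (k q) (lie_bracket M A X Y q) = twist q (X q) (Y q)"
proof -
  note o = orthonormal3D[OF frame_orthonormal[OF q]]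
  note Xq = vfield_tangent[OF X(1) q] and Yq = vfield_tangent[OF Y(1) q]
  have nt: "nab q (X q) Y \<in> T q" "nab q (Y q) X \<in> T q"
    by (intro nab_tangent[OF W _ q] X Y Xq Yq)+
  have "g q (k q) (nab q (X q) Y) = - g q (nab q (X q) k) (Y q)"
    "g q (k q) (nab q (Y q) X) = - g q (nab q (Y q) k) (X q)"
    by (rule metric_compatible_const[OF W kW Y(1) q Xq Y(2)], assumption)
       (rule metric_compatible_const[OF W kW X(1) q Yq X(2)], assumption)
  then show ?thesis
    unfolding torsion_free[OF W X(1) Y(1) q] twist_def by (simp add: g_diff_right o nt)
qed

lemma bracket_k:
  assumes q: "q \<in> W"
  shows "g q (lie_bracket M A k x q) (k q) = 0" "g q (lie_bracket M A k y q) (k q) = 0"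
    "g q (lie_bracket M A k x q) (x q) = - a q" "g q (lie_bracket M A k x q) (y q) = m q - b q"
    "g q (lie_bracket M A k y q) (x q) = - m q - c q" "g q (lie_bracket M A k y q) (y q) = - d q"
proof -
  have qU: "q \<in> U" using q WU by blast
  note o = orthonormal3D[OF frame_orthonormal[OF q]]
  have nt: "nab q (k q) x \<in> T q" "nab q (k q) y \<in> T q" "nab q (x q) k \<in> T q" "nab q (y q) k \<in> T q"
    by (intro nab_tangent[OF W _ q] o xW yW kW)+
  show "g q (lie_bracket M A k x q) (k q) = 0" "g q (lie_bracket M A k y q) (k q) = 0"
    "g q (lie_bracket M A k x q) (x q) = - a q" "g q (lie_bracket M A k x q) (y q) = m q - b q"
    "g q (lie_bracket M A k y q) (x q) = - m q - c q" "g q (lie_bracket M A k y q) (y q) = - d q"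
    by (simp_all add: torsion_free[OF W kW xW q] torsion_free[OF W kW yW q] g_diff_left o nt
        frame_derivative[OF q] nab_k_orth(1)[OF qU] a_def b_def c_def d_def)
qed

text \<open>Since \<open>\<theta>\<close> is invariant under the flow of \<open>k\<close>, the derivative of \<open>\<theta>([x, y])\<close> is \<open>\<theta>([k, [x, y]])\<close>.
By the Jacobi identity it is a sum of values of \<open>twist\<close> on \<open>[k, x]\<close> and \<open>[k, y]\<close>, whose
components are given by \<open>bracket_k\<close>.\<close>

lemma rotation_evolution:
  assumes q: "q \<in> W"
  shows "k q \<omega> = - (a q + d q) * \<omega> q"
proof -
  let ?br = "lie_bracket M A"
  have qU: "q \<in> U" using q WU by blast
  note o = orthonormal3D[OF frame_orthonormal]
  note oq = orthonormal3D[OF frame_orthonormal[OF q]]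
  let ?z = "?br x y"
  have z: "vfield W ?z" and kx: "vfield W (?br k x)" and ky: "vfield W (?br k y)"
    by (intro lie_bracket_vfield W xW yW kW)+
  note zq = vfield_tangent[OF z q] and kxq = vfield_tangent[OF kx q] and kyq = vfield_tangent[OF ky q]
  have perp: "g r (k r) (?br k x r) = 0" "g r (k r) (?br k y r) = 0" if "r \<in> W" for r
    using bracket_k(1,2)[OF that] g_sym[OF o(1)[OF that] o(2)[OF that]]
      vfield_tangent[OF kx that] vfield_tangent[OF ky that] by metis+
  have nt: "nab q (k q) ?z \<in> T q" "nab q (?z q) k \<in> T q"
    by (intro nab_tangent[OF W _ q] z kW zq oq)+
  have bt: "?br x (?br k y) q \<in> T q" "?br y (?br k x) q \<in> T q"
    by (intro vfield_tangent[OF _ q] lie_bracket_vfield W xW yW kx ky)+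
  have "k q \<omega> = k q (\<lambda>r. g r (k r) (?z r))"
    by (rule tangent_cong[OF W q oq(2)]) (simp add: \<omega>_def bracket_inner xW yW o)
  also have "\<dots> = g q (nab q (k q) k) (?z q) + g q (k q) (nab q (k q) ?z)"
    by (rule metric_compatible[OF W kW z q oq(2)])
  also have "\<dots> = g q (k q) (nab q (k q) ?z -\<^sub>T nab q (?z q) k)"
    by (simp add: geodesic[OF qU] g_zero_left g_diff_right oq zq nt nab_k_orth(2)[OF qU zq])
  also have "\<dots> = g q (k q) (?br k ?z q)"
    unfolding torsion_free[OF W kW z q] ..
  also have "\<dots> = g q (k q) (?br x (?br k y) q) - g q (k q) (?br y (?br k x) q)"
    unfolding jacobi_identity[OF W kW xW yW q] by (rule g_diff_right[OF oq(1) bt oq(2)])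
  also have "g q (k q) (?br x (?br k y) q) = twist q (x q) (?br k y q)"
    by (rule bracket_inner[OF q xW o(8) ky perp(2)])
  also have "g q (k q) (?br y (?br k x) q) = twist q (y q) (?br k x q)"
    by (rule bracket_inner[OF q yW o(9) kx perp(1)])
  also have "twist q (x q) (?br k y q) - twist q (y q) (?br k x q) = - (a q + d q) * \<omega> q"
    unfolding twist_expand[OF qU frame_orthonormal[OF q] oq(3) kyq] twist_expand[OF qU frame_orthonormal[OF q] oq(4) kxq]
    by (simp add: bracket_k[OF q] oq \<omega>_def algebra_simps)
  finally show ?thesis .
qed

text \<open>Differentiate \<open>\<langle>\<nabla>\<^sub>e k, e\<rangle>\<close> along \<open>k\<close> and replace the second derivative of \<open>k\<close> by the curvature.\<close>

lemma raychaudhuri_diagonal: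
  assumes q: "q \<in> W" and e: "vfield W e"
  shows "k q (\<lambda>r. g r (nab r (e r) k) (e r)) =
    - g q (radial_curv e q) (e q) - g q (nab q (nab q (e q) k -\<^sub>T nab q (k q) e) k) (e q)
    + g q (nab q (e q) k) (nab q (k q) e)"
proof -
  have qU: "q \<in> U" using q WU by blast
  note o = orthonormal3D[OF frame_orthonormal[OF q]]
  note eq = vfield_tangent[OF e q]
  have n: "vfield W (\<lambda>r. nab r (e r) k)" by (rule nab_vfield[OF W kW e])
  have nt: "nab q (k q) (\<lambda>r. nab r (e r) k) \<in> T q" "nab q (nab q (e q) k -\<^sub>T nab q (k q) e) k \<in> T q"
    by (intro nab_tangent[OF W _ q] tangent_diff n kW e eq o)+
  have "g q (radial_curv e q) (e q) = - g q (nab q (k q) (\<lambda>r. nab r (e r) k)) (e q)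
      - g q (nab q (nab q (e q) k -\<^sub>T nab q (k q) e) k) (e q)"
    unfolding radial_curv_eq[OF W WU e q] using o nt eq by (simp add: g_simps)
  then show ?thesis
    using metric_compatible[OF W n e q o(2)] by simp
qed

text \<open>In the sum of the two diagonal equations the terms with \<open>m\<close> cancel.\<close>

lemma raychaudhuri:
  assumes q: "q \<in> W"
  shows "k q a + k q d = - ricci M A g nab k k q - (a q ^ 2 + 2 * b q * c q + d q ^ 2)"
proof -
  have qU: "q \<in> U" using q WU by blast
  note o = orthonormal3D[OF frame_orthonormal[OF q]]
  have nt: "nab q (k q) x \<in> T q" "nab q (k q) y \<in> T q" "nab q (x q) k \<in> T q" "nab q (y q) k \<in> T q"
    by (intro nab_tangent[OF W _ q] o xW yW kW)+
  have D: "a = (\<lambda>r. g r (nab r (x r) k) (x r))" "d = (\<lambda>r. g r (nab r (y r) k) (y r))"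
    by (simp_all add: fun_eq_iff a_def d_def)
  have kx: "k q a = - g q (radial_curv x q) (x q) - (a q * a q + (b q - m q) * c q) + m q * b q"
    unfolding D(1)[THEN arg_cong[where f = "k q"]] raychaudhuri_diagonal[OF q xW]
    by (simp add: nab_k_inner_frame[OF q] g_simps o nt frame_derivative[OF q])
  have ky: "k q d = - g q (radial_curv y q) (y q) - (d q * d q + (c q + m q) * b q) - m q * c q"
    unfolding D(2)[THEN arg_cong[where f = "k q"]] raychaudhuri_diagonal[OF q yW]
    by (simp add: nab_k_inner_frame[OF q] g_simps o nt frame_derivative[OF q])
  show ?thesis
    unfolding kx ky ricci_eq[OF WU frame q] by (simp add: power2_eq_square algebra_simps)
qed

end

section \<open>Scalar differential equations\<close>

text \<open>With an antiderivative \<open>P\<close> of \<open>h\<close> the function \<open>w exp(- P)\<close> is constant.\<close>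

lemma linear_ode_zero_iff:
  fixes w h :: "real \<Rightarrow> real"
  assumes w: "\<And>s. s \<in> {l..r} \<Longrightarrow> (w has_real_derivative h s * w s) (at s within {l..r})"
    and h: "continuous_on {l..r} h" and s: "s \<in> {l..r}" "s' \<in> {l..r}"
  shows "w s = 0 \<longleftrightarrow> w s' = 0"
proof -
  obtain P where P: "(P has_real_derivative h s) (at s within {l..r})" if "s \<in> {l..r}" for s
    using antiderivative_continuous[OF h] by (metis has_real_derivative_iff_has_vector_derivative)
  have "((\<lambda>s. w s * exp (- P s)) has_real_derivative 0) (at s within {l..r})" if "s \<in> {l..r}" for s
    by (rule derivative_eq_intros w[OF that] P[OF that] refl | simp add: algebra_simps)+
  then have "\<exists>c. \<forall>s\<in>{l..r}. w s * exp (- P s) = c"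
    by (intro has_field_derivative_zero_constant) auto
  then have "w s * exp (- P s) = w s' * exp (- P s')" using s by auto
  then show ?thesis by auto
qed

text \<open>If \<open>D t < 0\<close>, then \<open>D\<close> stays negative after \<open>t\<close>, and \<open>1 / D\<close> grows at least at rate \<open>1/2\<close> from
\<open>1 / D t\<close>. So it would be nonnegative at time \<open>t - 2 / D t\<close>.\<close>

lemma riccati_nonneg:
  fixes D D' :: "real \<Rightarrow> real"
  assumes D: "\<And>s. (D has_real_derivative D' s) (at s)" and le: "\<And>s. D' s \<le> - (D s ^ 2 / 2)"
  shows "D t \<ge> 0"
proof (rule ccontr)
  assume "\<not> D t \<ge> 0"
  then have t: "D t < 0" by simp
  have neg: "D s < 0" if "t \<le> s" for s
  proof -
    have "D s \<le> D t"
    proof (rule DERIV_nonpos_imp_nonincreasing[OF that])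
      fix x show "\<exists>y. DERIV D x :> y \<and> y \<le> 0"
        using D[of x] le[of x] by (intro exI[of _ "D' x"] conjI) (auto intro: order_trans)
    qed
    then show ?thesis using t by simp
  qed
  define s where "s = t - 2 / D t"
  have s: "t \<le> s" using t by (simp add: s_def divide_nonneg_neg)
  have "inverse (D t) - t / 2 \<le> inverse (D s) - s / 2"
  proof (rule DERIV_nonneg_imp_nondecreasing[OF s])
    fix x assume "t \<le> x"
    then have n: "D x \<noteq> 0" using neg[of x] by simp
    have "((\<lambda>s. inverse (D s) - s / 2) has_real_derivative - (inverse (D x) * D' x * inverse (D x)) - 1 / 2) (at x)"
      by (auto intro!: derivative_eq_intros D n)
    moreover have "0 \<le> - (inverse (D x) * D' x * inverse (D x)) - 1 / 2"
      using le[of x] n by (simp add: field_simps power2_eq_square)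
    ultimately show "\<exists>y. ((\<lambda>s. inverse (D s) - s / 2) has_real_derivative y) (at x) \<and> 0 \<le> y" by blast
  qed
  then have "0 \<le> inverse (D s)" by (simp add: s_def field_simps)
  then show False using neg[OF s] by simp
qed

section \<open>Propagation along integral curves\<close>

context geodesic_unit_field
begin

lemma frame_along_curve:
  assumes \<gamma>: "integral_curve M A U k J \<gamma>" and t: "t \<in> J"
  obtains W x y e where "adapted_frame M A g nab U k W x y" "e > 0"
    "\<And>s. \<bar>s - t\<bar> \<le> e \<Longrightarrow> s \<in> J \<and> \<gamma> s \<in> W"
proof -
  have tU: "\<gamma> t \<in> U" and oJ: "open J" and cont: "continuous_map (top_of_set J) M \<gamma>"
    using \<gamma> t unfolding integral_curve_def smooth_curve_def by auto
  obtain W x y where W: "\<gamma> t \<in> W" "W \<subseteq> U" "frame_on W k x y"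
    using exists_frame_on[OF U tU k unit] by blast
  have "openin (top_of_set J) {s \<in> topspace (top_of_set J). \<gamma> s \<in> W}"
    using cont W(3) unfolding continuous_map frame_on_def by blast
  then have "open {s \<in> J. \<gamma> s \<in> W}" by (simp add: openin_open_eq[OF oJ])
  then obtain e where e: "e > 0" "cball t e \<subseteq> {s \<in> J. \<gamma> s \<in> W}"
    using t W(1) open_contains_cball_eq by (metis (mono_tags, lifting) mem_Collect_eq)
  have "adapted_frame M A g nab U k W x y"
    by unfold_locales (use W in auto)
  then show thesis
    by (rule that[OF _ e(1)]) (use e(2) in \<open>auto simp: dist_real_def abs_minus_commute subset_iff\<close>)
qed

end

lemma (in adapted_frame) hypersurface_orthogonal_iff_\<omega>:
  "q \<in> W \<Longrightarrow> hypersurface_orthogonal M A g nab k q \<longleftrightarrow> \<omega> q = 0"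
  unfolding \<omega>_def using WU by (intro hypersurface_orthogonal_iff frame_orthonormal) auto

lemma (in adapted_frame) divergence_eq_trace: "q \<in> W \<Longrightarrow> divergence M A g nab k q = a q + d q"
  unfolding a_def d_def using WU by (intro divergence_eq frame_orthonormal) auto

lemma (in adapted_frame) derivative_along_curve:
  assumes "integral_curve M A U k J \<gamma>" "t \<in> J" "\<gamma> t \<in> W"
  shows "((\<lambda>s. a (\<gamma> s)) has_real_derivative k (\<gamma> t) a) (at t)"
    and "((\<lambda>s. d (\<gamma> s)) has_real_derivative k (\<gamma> t) d) (at t)"
    and "((\<lambda>s. \<omega> (\<gamma> s)) has_real_derivative k (\<gamma> t) \<omega>) (at t)"
  using integral_curve_has_derivative[OF assms(1,2) W assms(3)] smooth_abcd by blast+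

context geodesic_unit_field
begin

text \<open>By the linear equation for \<open>\<omega>\<close>, the truth value is locally constant on the parameter interval.
Frames at different points of the curve need not fit together, which is why it, and not \<open>\<omega>\<close>, is
followed along the curve.\<close>

lemma hypersurface_orthogonal_along_curve:
  assumes \<gamma>: "integral_curve M A U k J \<gamma>" and t: "t \<in> J" "t' \<in> J"
  shows "hypersurface_orthogonal M A g nab k (\<gamma> t) \<longleftrightarrow> hypersurface_orthogonal M A g nab k (\<gamma> t')"
proof (rule connected_local_const[OF _ t])
  show "connected J" using \<gamma> is_interval_connected unfolding integral_curve_def by blast
  show "\<forall>t\<in>J. \<forall>\<^sub>F s in at t within J.
      hypersurface_orthogonal M A g nab k (\<gamma> t) = hypersurface_orthogonal M A g nab k (\<gamma> s)"
  proof
    fix t assume "t \<in> J"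
    then obtain W x y e where F: "adapted_frame M A g nab U k W x y" "e > 0"
      and e: "\<And>s. \<bar>s - t\<bar> \<le> e \<Longrightarrow> s \<in> J \<and> \<gamma> s \<in> W"
      using frame_along_curve[OF \<gamma>] by metis
    interpret F: adapted_frame M A g nab U k W x y by (rule F(1))
    let ?h = "\<lambda>s. - (F.a (\<gamma> s) + F.d (\<gamma> s))" and ?I = "{t - e..t + e}"
    have I: "s \<in> J" "\<gamma> s \<in> W" if "s \<in> ?I" for s using e[of s] that by (auto simp: abs_le_iff)
    note der = F.derivative_along_curve[OF \<gamma> I, THEN DERIV_subset[OF _ subset_UNIV]]
    have "F.\<omega> (\<gamma> t) = 0 \<longleftrightarrow> F.\<omega> (\<gamma> s) = 0" if "s \<in> ?I" for s
    proof (rule linear_ode_zero_iff[where l = "t - e" and r = "t + e" and h = ?h and w = "\<lambda>s. F.\<omega> (\<gamma> s)"])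
      show "((\<lambda>s. F.\<omega> (\<gamma> s)) has_real_derivative ?h s * F.\<omega> (\<gamma> s)) (at s within ?I)" if "s \<in> ?I" for s
        using der(3)[OF that that] F.rotation_evolution[OF I(2)[OF that]] by simp
      show "continuous_on ?I ?h"
        by (intro continuous_intros; rule DERIV_continuous_on, rule der; assumption)
    qed (use that F(2) in auto)
    then have "hypersurface_orthogonal M A g nab k (\<gamma> t) = hypersurface_orthogonal M A g nab k (\<gamma> s)"
      if "s \<in> ?I" for s
      using that F.hypersurface_orthogonal_iff_\<omega>[OF I(2)] F(2) by simp
    then show "\<forall>\<^sub>F s in at t within J.
        hypersurface_orthogonal M A g nab k (\<gamma> t) = hypersurface_orthogonal M A g nab k (\<gamma> s)"
      unfolding eventually_at using F(2)
      by (intro exI[of _ e]) (auto simp: dist_real_def abs_less_iff)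
  qed
qed

text \<open>Vanishing rotation means \<open>b = c\<close>, and then \<open>a\<^sup>2 + 2 b\<^sup>2 + d\<^sup>2 \<ge> (a + d)\<^sup>2 / 2\<close>.\<close>

lemma divergence_derivative_le:
  assumes \<gamma>: "integral_curve M A U k J \<gamma>" and t: "t \<in> J"
    and ric: "ricci M A g nab k k (\<gamma> t) \<ge> 0" and ho: "hypersurface_orthogonal M A g nab k (\<gamma> t)"
  obtains D' where "((\<lambda>s. divergence M A g nab k (\<gamma> s)) has_real_derivative D') (at t)"
    "D' \<le> - (divergence M A g nab k (\<gamma> t) ^ 2 / 2)"
proof -
  obtain W x y e where F: "adapted_frame M A g nab U k W x y" "e > 0"
    and e: "\<And>s. \<bar>s - t\<bar> \<le> e \<Longrightarrow> s \<in> J \<and> \<gamma> s \<in> W"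
    using frame_along_curve[OF \<gamma> t] by metis
  interpret F: adapted_frame M A g nab U k W x y by (rule F(1))
  have tW: "\<gamma> t \<in> W" using e[of t] F(2) by simp
  let ?D' = "k (\<gamma> t) F.a + k (\<gamma> t) F.d"
  have "((\<lambda>s. F.a (\<gamma> s) + F.d (\<gamma> s)) has_real_derivative ?D') (at t)"
    by (intro DERIV_add F.derivative_along_curve[OF \<gamma> t tW])
  then have 1: "((\<lambda>s. divergence M A g nab k (\<gamma> s)) has_real_derivative ?D') (at t)"
  proof (rule has_field_derivative_transform_within[of _ _ _ _ e])
    fix s assume "dist s t < e"
    then show "F.a (\<gamma> s) + F.d (\<gamma> s) = divergence M A g nab k (\<gamma> s)"
      using e[of s] F.divergence_eq_trace by (simp add: dist_real_def)
  qed (use F(2) in auto)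
  have bc: "F.c (\<gamma> t) = F.b (\<gamma> t)"
    using ho F.hypersurface_orthogonal_iff_\<omega>[OF tW] F.\<omega>_eq by simp
  have "0 \<le> (F.a (\<gamma> t) - F.d (\<gamma> t)) ^ 2 + (2 * F.b (\<gamma> t)) ^ 2" by simp
  then have "(F.a (\<gamma> t) + F.d (\<gamma> t)) ^ 2 / 2 \<le>
      F.a (\<gamma> t) ^ 2 + 2 * F.b (\<gamma> t) * F.b (\<gamma> t) + F.d (\<gamma> t) ^ 2"
    by (simp add: power2_eq_square algebra_simps)
  then have "?D' \<le> - ((F.a (\<gamma> t) + F.d (\<gamma> t)) ^ 2 / 2)"
    using F.raychaudhuri[OF tW] ric unfolding bc by linarith
  then show thesis
    using that[OF 1] F.divergence_eq_trace[OF tW] by simp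
qed

lemma divergence_nonneg_along_complete_curve:
  assumes \<gamma>: "integral_curve M A U k UNIV \<gamma>"
    and ric: "\<And>t. ricci M A g nab k k (\<gamma> t) \<ge> 0"
    and ho: "\<And>t. hypersurface_orthogonal M A g nab k (\<gamma> t)"
  shows "divergence M A g nab k (\<gamma> t) \<ge> 0"
proof -
  have "\<exists>D'. ((\<lambda>s. divergence M A g nab k (\<gamma> s)) has_real_derivative D') (at t) \<and>
    D' \<le> - (divergence M A g nab k (\<gamma> t) ^ 2 / 2)" for t
    using divergence_derivative_le[OF \<gamma> UNIV_I ric ho] by metis
  then obtain D' where "\<And>t. ((\<lambda>s. divergence M A g nab k (\<gamma> s)) has_real_derivative D' t) (at t)"
    "\<And>t. D' t \<le> - (divergence M A g nab k (\<gamma> t) ^ 2 / 2)" by metis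
  then show ?thesis by (rule riccati_nonneg)
qed

end

theorem proposition1:
  fixes M :: "'a topology" and A :: "'a chart set" and g :: "'a metric"
    and nab :: "'a connection" and U :: "'a set" and k :: "'a vfield"
    and p :: 'a and J :: "real set" and \<gamma> :: "real \<Rightarrow> 'a"
  assumes "riemannian_3_manifold M A g"
    and "levi_civita M A g nab"
    and "openin M U"
    and "smooth_vfield M A U k"
    and "\<forall>q\<in>U. g q (k q) (k q) = 1"
    and "\<forall>q\<in>U. nab q (k q) k = tv_zero"
    and "p \<in> U"
    and "maximal_integral_curve M A U k p J \<gamma>"
  shows "(hypersurface_orthogonal M A g nab k p \<longleftrightarrow>
            (\<forall>t\<in>J. hypersurface_orthogonal M A g nab k (\<gamma> t))) \<and>
         (J = UNIV \<and> (\<forall>t\<in>J. ricci M A g nab k k (\<gamma> t) \<ge> 0) \<and>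
            (\<forall>t\<in>J. hypersurface_orthogonal M A g nab k (\<gamma> t)) \<longrightarrow>
            (\<forall>t\<in>J. divergence M A g nab k (\<gamma> t) \<ge> 0))"
proof -
  interpret geodesic_unit_field M A g nab U k
    by unfold_locales (use assms(1-6) in \<open>auto simp: riemannian_3_manifold_def\<close>)
  have \<gamma>: "integral_curve M A U k J \<gamma>" "0 \<in> J" "\<gamma> 0 = p"
    using assms(8) unfolding maximal_integral_curve_def by auto
  have "hypersurface_orthogonal M A g nab k p \<longleftrightarrow> hypersurface_orthogonal M A g nab k (\<gamma> t)" if "t \<in> J" for t
    using hypersurface_orthogonal_along_curve[OF \<gamma>(1,2) that] \<gamma>(3) by simp
  then show ?thesis
    using \<gamma>(1,2) divergence_nonneg_along_complete_curve[of \<gamma>] by auto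
qed

end
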